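(* Let $E$ and $F$ be atomic Banach lattices with order continuous norms. Then: (1) if $T$ is a positive operator on $E$ then $r_{\rm ess}(T)\in\sigma_{\rm ess}(T)$; (2) if $S,T\colon E\to E$ are operators and $T$ dominates $S$ then $r_{\rm ess}(S)\le r_{\rm ess}(T)$; (3) if $S,T\colon E\to F$ are operators and $T$ dominates $S$ then $\chi(S)\le\chi(T)$.
   Context: Banach lattices are complex unless specified otherwise; operators are linear and bounded. An operator $T$ is positive if it maps positive vectors to positive vectors. $S$ is dominated by $T$ (equivalently, $T$ dominates $S$) if $|Sx|\le T|x|$ for every $x$. The Calkin algebra of a Banach space $X$ is the quotient of the algebra $\mathcal L(X)$ of bounded operators by the closed ideal of compact operators. The essential spectrum $\sigma_{\rm ess}(T)$ and essential spectral radius $r_{\rm ess}(T)$ of $T\in\mathcal L(X)$ are the spectrum and spectral radius of the canonical image of $T$ in the Calkin algebra. For a bounded subset $A$ of a Banach space, $\chi(A)=\inf\{\delta>0 : A \text{ can be covered by finitely many balls of radius }\delta\}$; for an operator $T\colon X\to Y$, $\chi(T)=\chi(TB_X)$, where $B_X$ is the unit ball of $X$.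
   Formalization: Part (1) is stated for infinite-dimensional E only: if E is finite-dimensional, every operator is compact, the Calkin algebra is zero and the essential spectrum is empty, so (1) fails there. In (2) the essential spectral radius is taken to be 0 in finite dimension. *)

theory Defs
  imports
    "HOL-Analysis.Analysis"
    "HOL-Library.Lattice_Algebras"
    "HOL-Algebra.QuotRing"
begin

section \<open>Complex Banach spaces and operators\<close>

class scaleC = scaleR +
  fixes scaleC :: "complex \<Rightarrow> 'a \<Rightarrow> 'a" (infixr \<open>*\<^sub>C\<close> 75)

class complex_banach = banach + scaleC +
  assumes scaleC_add_right: "a *\<^sub>C (x + y) = a *\<^sub>C x + a *\<^sub>C y"
    and scaleC_add_left: "(a + b) *\<^sub>C x = a *\<^sub>C x + b *\<^sub>C x"
    and scaleC_scaleC: "a *\<^sub>C b *\<^sub>C x = (a * b) *\<^sub>C x"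
    and scaleC_of_real: "complex_of_real r *\<^sub>C x = r *\<^sub>R x"
    and norm_scaleC: "norm (a *\<^sub>C x) = cmod a * norm x"

definition bounded_clinear :: "('a::complex_banach \<Rightarrow> 'b::complex_banach) \<Rightarrow> bool" where
  "bounded_clinear T \<longleftrightarrow> bounded_linear T \<and> (\<forall>c x. T (c *\<^sub>C x) = c *\<^sub>C T x)"

definition compact_operator :: "('a::complex_banach \<Rightarrow> 'b::complex_banach) \<Rightarrow> bool" where
  "compact_operator T \<longleftrightarrow> bounded_clinear T \<and> compact (closure (T ` cball 0 1))"


section \<open>Measure of non-compactness\<close>

definition ball_noncompactness :: "'a::metric_space set \<Rightarrow> real" where
  "ball_noncompactness A = Inf {\<delta>. 0 < \<delta> \<and> (\<exists>C. finite C \<and> A \<subseteq> (\<Union>c\<in>C. cball c \<delta>))}"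

definition op_noncompactness :: "('a::complex_banach \<Rightarrow> 'b::complex_banach) \<Rightarrow> real" where
  "op_noncompactness T = ball_noncompactness (T ` cball 0 1)"


section \<open>The Calkin algebra and the essential spectrum\<close>

definition operator_algebra :: "('a::complex_banach \<Rightarrow> 'a) ring" where
  "operator_algebra =
    \<lparr>carrier = {T. bounded_clinear T}, mult = (\<circ>), one = id,
     zero = (\<lambda>x. 0), add = (\<lambda>S T x. S x + T x)\<rparr>"

definition calkin_algebra :: "('a::complex_banach \<Rightarrow> 'a) set ring" where
  "calkin_algebra = operator_algebra Quot {T. compact_operator T}"

definition calkin_proj :: "('a::complex_banach \<Rightarrow> 'a) \<Rightarrow> ('a \<Rightarrow> 'a) set" where
  "calkin_proj T = {T. compact_operator T} +>\<^bsub>operator_algebra\<^esub> T"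

text \<open>The image of \<open>\<lambda>x. c *\<^sub>C x\<close> is \<open>c\<close> times the unit of the Calkin algebra.\<close>

definition essential_spectrum :: "('a::complex_banach \<Rightarrow> 'a) \<Rightarrow> complex set" where
  "essential_spectrum T =
    {c. calkin_proj (\<lambda>x. c *\<^sub>C x) \<ominus>\<^bsub>calkin_algebra\<^esub> calkin_proj T \<notin> Units calkin_algebra}"

text \<open>The spectrum is empty only if the Calkin algebra is zero, that is, in finite dimension;
  adding \<open>0\<close> makes the spectral radius \<open>0\<close> there and changes nothing otherwise.\<close>

definition essential_spectral_radius :: "('a::complex_banach \<Rightarrow> 'a) \<Rightarrow> real" where
  "essential_spectral_radius T = Sup (insert 0 (cmod ` essential_spectrum T))"


subsection \<open>The Calkin algebra is a ring\<close>

lemma bounded_clinearI: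
  assumes "bounded_linear T" "\<And>c x. T (c *\<^sub>C x) = c *\<^sub>C T x"
  shows "bounded_clinear T"
  using assms by (simp add: bounded_clinear_def)

lemma bounded_clinearD:
  assumes "bounded_clinear T"
  shows "bounded_linear T" "T (c *\<^sub>C x) = c *\<^sub>C T x"
  using assms by (simp_all add: bounded_clinear_def)

lemma scaleC_zero_right: "c *\<^sub>C (0::'a::complex_banach) = 0"
  by (metis add_cancel_right_right scaleC_add_right)

lemma scaleC_minus_right: "c *\<^sub>C (- x) = - (c *\<^sub>C (x::'a::complex_banach))"
  by (metis add.right_inverse minus_unique scaleC_add_right scaleC_zero_right)

lemma bounded_clinear_zero: "bounded_clinear (\<lambda>x. 0)"
  by (simp add: bounded_clinear_def scaleC_zero_right bounded_linear_zero)

lemma bounded_clinear_id: "bounded_clinear id"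
  by (simp add: bounded_clinear_def id_def bounded_linear_ident)

lemma bounded_clinear_add:
  "bounded_clinear S \<Longrightarrow> bounded_clinear T \<Longrightarrow> bounded_clinear (\<lambda>x. S x + T x)"
  by (simp add: bounded_clinear_def scaleC_add_right bounded_linear_add)

lemma bounded_clinear_minus: "bounded_clinear T \<Longrightarrow> bounded_clinear (\<lambda>x. - T x)"
  by (simp add: bounded_clinear_def scaleC_minus_right bounded_linear_minus)

lemma bounded_clinear_comp:
  "bounded_clinear S \<Longrightarrow> bounded_clinear T \<Longrightarrow> bounded_clinear (S \<circ> T)"
  by (auto simp: bounded_clinear_def o_def intro: bounded_linear_compose)

lemma bounded_clinear_scaleC: "bounded_clinear (\<lambda>x. c *\<^sub>C x)"
proof (rule bounded_clinearI)
  show "bounded_linear (\<lambda>x::'a. c *\<^sub>C x)"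
    by (rule bounded_linear_intro[where K = "cmod c"])
       (simp_all add: scaleC_add_right norm_scaleC mult.commute scaleC_scaleC flip: scaleC_of_real)
qed (simp add: scaleC_scaleC mult.commute)

lemma compact_operator_iff:
  "compact_operator T \<longleftrightarrow> bounded_clinear T \<and> (\<exists>K. compact K \<and> T ` cball 0 1 \<subseteq> K)"
proof -
  have "compact (closure A)" if "compact K" "A \<subseteq> K" for A K :: "'b set"
  proof -
    have "closure A \<subseteq> K" using that by (simp add: closure_minimal compact_imp_closed)
    then show ?thesis using compact_Int_closed[OF that(1) closed_closure[of A]] by (simp add: Int_absorb1)
  qed
  then show ?thesis
    unfolding compact_operator_def by (meson closure_subset)
qed

lemma ring_operator_algebra: "ring (operator_algebra :: ('a::complex_banach \<Rightarrow> 'a) ring)"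
proof (rule ringI)
  show "abelian_group (operator_algebra :: ('a \<Rightarrow> 'a) ring)"
  proof (rule abelian_groupI)
    fix T :: "'a \<Rightarrow> 'a"
    assume "T \<in> carrier operator_algebra"
    then show "\<exists>S\<in>carrier operator_algebra. S \<oplus>\<^bsub>operator_algebra\<^esub> T = \<zero>\<^bsub>operator_algebra\<^esub>"
      by (intro bexI[of _ "\<lambda>x. - T x"])
         (auto simp: operator_algebra_def bounded_clinear_minus)
  qed (auto simp: operator_algebra_def bounded_clinear_add bounded_clinear_zero add_ac)
  show "Group.monoid (operator_algebra :: ('a \<Rightarrow> 'a) ring)"
    by (rule monoidI)
       (auto simp: operator_algebra_def bounded_clinear_comp bounded_clinear_id)
qed (auto simp: operator_algebra_def fun_eq_iff bounded_clinear_def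
      bounded_linear.linear linear_add)

lemma ideal_compact_operators:
  "ideal {T. compact_operator T} (operator_algebra :: ('a::complex_banach \<Rightarrow> 'a) ring)"
proof -
  interpret R: ring "operator_algebra :: ('a \<Rightarrow> 'a) ring"
    by (rule ring_operator_algebra)
  have inv: "\<ominus>\<^bsub>operator_algebra\<^esub> T = (\<lambda>x. - T x)" if "bounded_clinear T" for T :: "'a \<Rightarrow> 'a"
    using that by (intro R.minus_equality) (auto simp: operator_algebra_def bounded_clinear_minus)
  show ?thesis
  proof (rule idealI[OF ring_operator_algebra])
    show "subgroup {T. compact_operator T} (add_monoid (operator_algebra :: ('a \<Rightarrow> 'a) ring))"
    proof (rule subgroup.intro)
      show "{T :: 'a \<Rightarrow> 'a. compact_operator T} \<subseteq> carrier (add_monoid operator_algebra)"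
        by (auto simp: operator_algebra_def compact_operator_def)
    next
      fix S T :: "'a \<Rightarrow> 'a"
      assume "S \<in> {T. compact_operator T}" "T \<in> {T. compact_operator T}"
      then obtain K L where *: "bounded_clinear S" "bounded_clinear T" "compact K" "compact L"
        "S ` cball 0 1 \<subseteq> K" "T ` cball 0 1 \<subseteq> L"
        by (auto simp: compact_operator_iff)
      have "compact_operator (\<lambda>x. S x + T x)"
        unfolding compact_operator_iff
        using * compact_sums[of K L] bounded_clinear_add[of S T]
        by (intro conjI exI[of _ "{x + y |x y. x \<in> K \<and> y \<in> L}"]) blast+
      then show "S \<otimes>\<^bsub>add_monoid operator_algebra\<^esub> T \<in> {T. compact_operator T}"
        by (simp add: operator_algebra_def)
    next
      show "\<one>\<^bsub>add_monoid operator_algebra\<^esub> \<in> {T :: 'a \<Rightarrow> 'a. compact_operator T}"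
        by (auto simp: operator_algebra_def compact_operator_iff bounded_clinear_zero
            intro!: exI[of _ "{0}"])
    next
      fix T :: "'a \<Rightarrow> 'a"
      assume "T \<in> {T. compact_operator T}"
      then obtain K where *: "bounded_clinear T" "compact K" "T ` cball 0 1 \<subseteq> K"
        by (auto simp: compact_operator_iff)
      have "compact_operator (\<lambda>x. - T x)"
        unfolding compact_operator_iff
        using * compact_negations[of K] bounded_clinear_minus[of T]
        by (intro conjI exI[of _ "uminus ` K"]) auto
      then show "inv\<^bsub>add_monoid operator_algebra\<^esub> T \<in> {T. compact_operator T}"
        using inv[OF *(1)] by (simp add: a_inv_def)
    qed
  next
    fix K S :: "'a \<Rightarrow> 'a"
    assume "K \<in> {T. compact_operator T}" "S \<in> carrier operator_algebra"
    then obtain C where *: "bounded_clinear K" "compact C" "K ` cball 0 1 \<subseteq> C" "bounded_clinear S"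
      by (auto simp: compact_operator_iff operator_algebra_def)
    have "compact (S ` C)"
      using * by (intro compact_continuous_image)
        (auto simp: bounded_clinear_def linear_continuous_on)
    then have "compact_operator (S \<circ> K)"
      unfolding compact_operator_iff
      using * bounded_clinear_comp[of S K] by (intro conjI exI[of _ "S ` C"]) auto
    then show "S \<otimes>\<^bsub>operator_algebra\<^esub> K \<in> {T. compact_operator T}"
      by (simp add: operator_algebra_def)
    obtain b where b: "b > 0" "\<And>x. norm (S x) \<le> norm x * b"
      using bounded_linear.pos_bounded[OF bounded_clinearD(1)[OF *(4)]] by blast
    have "(K \<circ> S) x \<in> (\<lambda>y. b *\<^sub>R y) ` C" if "x \<in> cball 0 1" for x
    proof -
      have "norm (S x) \<le> b"
        using b(2)[of x] that b(1)
        by (smt (verit) mem_cball_0 mult_left_le_one_le norm_ge_zero)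
      then have "S x /\<^sub>R b \<in> cball 0 1"
        using b(1) by (simp add: field_simps)
      then have "K (S x /\<^sub>R b) \<in> C"
        using *(3) by blast
      moreover have "K (S x) = b *\<^sub>R K (S x /\<^sub>R b)"
        using b(1) by (simp add: linear_scale[OF bounded_linear.linear[OF bounded_clinearD(1)[OF *(1)]]])
      ultimately show ?thesis by auto
    qed
    then have "compact_operator (K \<circ> S)"
      unfolding compact_operator_iff
      using * bounded_clinear_comp[of K S] compact_scaling[of C b]
      by (intro conjI exI[of _ "(\<lambda>y. b *\<^sub>R y) ` C"]) auto
    then show "K \<otimes>\<^bsub>operator_algebra\<^esub> S \<in> {T. compact_operator T}"
      by (simp add: operator_algebra_def)
  qed
qed

lemma ring_calkin_algebra: "ring (calkin_algebra :: ('a::complex_banach \<Rightarrow> 'a) set ring)"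
  unfolding calkin_algebra_def by (rule ideal.quotient_is_ring[OF ideal_compact_operators])


section \<open>Real Banach lattices\<close>

class banach_lattice = banach + ordered_real_vector + lattice_ab_group_add_abs +
  assumes norm_mono: "\<bar>x\<bar> \<le> \<bar>y\<bar> \<Longrightarrow> norm x \<le> norm y"

definition (in banach_lattice) atom :: "'a \<Rightarrow> bool" where
  "atom a \<longleftrightarrow> 0 < a \<and> (\<forall>x. 0 \<le> x \<and> x \<le> a \<longrightarrow> (\<exists>r. x = r *\<^sub>R a))"

class atomic_banach_lattice = banach_lattice +
  assumes atomic: "0 < x \<Longrightarrow> \<exists>a. atom a \<and> a \<le> x"

text \<open>Every net decreasing to \<open>0\<close> tends to \<open>0\<close> in norm. Up to reindexing such a net is a
  downward directed set \<open>D\<close> with infimum \<open>0\<close>, indexed by itself; the filter below is the filter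
  of its tails.\<close>

class order_continuous_banach_lattice = banach_lattice +
  assumes order_continuous:
    "\<lbrakk>D \<noteq> {}; \<And>x y. x \<in> D \<Longrightarrow> y \<in> D \<Longrightarrow> \<exists>z\<in>D. z \<le> x \<and> z \<le> y;
      \<And>x. x \<in> D \<Longrightarrow> 0 \<le> x; \<And>u. (\<And>x. x \<in> D \<Longrightarrow> u \<le> x) \<Longrightarrow> u \<le> 0\<rbrakk>
     \<Longrightarrow> (norm \<longlongrightarrow> 0) (INF d\<in>D. principal {x\<in>D. x \<le> d})"

lemma norm_abs_lattice: "norm \<bar>x\<bar> = norm (x::'a::banach_lattice)"
  by (intro antisym norm_mono) simp_all

lemma norm_mono_pos: "0 \<le> x \<Longrightarrow> x \<le> y \<Longrightarrow> norm x \<le> norm (y::'a::banach_lattice)"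
  by (rule norm_mono) (use order_trans in fastforce)

lemma LIMSEQ_nonneg_lattice:
  fixes X :: "nat \<Rightarrow> 'a::banach_lattice"
  assumes "X \<longlonglongrightarrow> x" "\<And>n. 0 \<le> X n"
  shows "0 \<le> x"
proof -
  have "norm (sup (- x) 0) \<le> norm (X n - x)" for n
  proof -
    have "- x \<le> X n - x" using assms(2)[of n] by simp
    also have "\<dots> \<le> \<bar>X n - x\<bar>" by (rule abs_ge_self)
    finally have "sup (- x) 0 \<le> \<bar>X n - x\<bar>" by simp
    then have "norm (sup (- x) 0) \<le> norm \<bar>X n - x\<bar>" by (intro norm_mono_pos) auto
    then show ?thesis by (simp add: norm_abs_lattice)
  qed
  moreover have "(\<lambda>n. norm (X n - x)) \<longlonglongrightarrow> 0"
    using assms(1) by (simp add: LIM_zero tendsto_norm_zero)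
  ultimately have "norm (sup (- x) 0) \<le> 0"
    by (meson LIMSEQ_le_const)
  then have "sup (- x) 0 = 0" by simp
  then have "- x \<le> 0" by (metis sup_ge1)
  then show ?thesis by simp
qed

lemma LIMSEQ_le_lattice:
  fixes X :: "nat \<Rightarrow> 'a::banach_lattice"
  assumes "X \<longlonglongrightarrow> x" "Y \<longlonglongrightarrow> y" "\<And>n. X n \<le> Y n"
  shows "x \<le> y"
  using LIMSEQ_nonneg_lattice[OF tendsto_diff[OF assms(2,1)]] assms(3) by simp


section \<open>Complexification of a Banach lattice\<close>

text \<open>A complex Banach lattice is the complexification \<open>E + iE\<close> of a real Banach lattice, with
  modulus \<open>\<bar>x + iy\<bar> = sup\<^sub>\<theta> (x cos \<theta> + y sin \<theta>)\<close> and norm \<open>\<parallel>z\<parallel> = \<parallel>\<bar>z\<bar>\<parallel>\<close>.\<close>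

codatatype 'a complexification = Cplx (re_part: 'a) (im_part: 'a)

lemma cplx_eq_iff: "z = w \<longleftrightarrow> re_part z = re_part w \<and> im_part z = im_part w"
  by (auto intro: complexification.expand)

definition complexify :: "'a::zero \<Rightarrow> 'a complexification" where
  "complexify x = Cplx x 0"

lemma complexify_sel [simp]: "re_part (complexify x) = x" "im_part (complexify x) = 0"
  by (simp_all add: complexify_def)

instantiation complexification :: (real_vector) real_vector
begin

primcorec zero_complexification where
  "re_part 0 = 0" | "im_part 0 = 0"

primcorec plus_complexification where
  "re_part (z + w) = re_part z + re_part w" | "im_part (z + w) = im_part z + im_part w"

primcorec uminus_complexification where
  "re_part (- z) = - re_part z" | "im_part (- z) = - im_part z"

primcorec minus_complexification where
  "re_part (z - w) = re_part z - re_part w" | "im_part (z - w) = im_part z - im_part w"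

primcorec scaleR_complexification where
  "re_part (r *\<^sub>R z) = r *\<^sub>R re_part z" | "im_part (r *\<^sub>R z) = r *\<^sub>R im_part z"

instance
  by standard (simp_all add: cplx_eq_iff scaleR_add_right scaleR_add_left)

end

instantiation complexification :: (real_vector) scaleC
begin

primcorec scaleC_complexification where
  "re_part (c *\<^sub>C z) = Re c *\<^sub>R re_part z - Im c *\<^sub>R im_part z"
| "im_part (c *\<^sub>C z) = Re c *\<^sub>R im_part z + Im c *\<^sub>R re_part z"

instance ..

end

text \<open>\<open>z \<le> w\<close> means that \<open>w - z\<close> is a positive vector of the real part.\<close>

instantiation complexification :: (ordered_real_vector) ordered_real_vector
begin

definition less_eq_complexification :: "'a complexification \<Rightarrow> 'a complexification \<Rightarrow> bool" where
  "z \<le> w \<longleftrightarrow> re_part z \<le> re_part w \<and> im_part z = im_part w"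

definition less_complexification :: "'a complexification \<Rightarrow> 'a complexification \<Rightarrow> bool" where
  "z < w \<longleftrightarrow> re_part z < re_part w \<and> im_part z = im_part w"

instance
  by standard
     (auto simp: less_eq_complexification_def less_complexification_def cplx_eq_iff
       scaleR_left_mono scaleR_right_mono)

end

definition modulus :: "'a::banach_lattice complexification \<Rightarrow> 'a" where
  "modulus z = (THE m. (\<forall>\<theta>. cos \<theta> *\<^sub>R re_part z + sin \<theta> *\<^sub>R im_part z \<le> m) \<and>
     (\<forall>u. (\<forall>\<theta>. cos \<theta> *\<^sub>R re_part z + sin \<theta> *\<^sub>R im_part z \<le> u) \<longrightarrow> m \<le> u))"

subsection \<open>Existence and properties of the modulus\<close>

lemma scaleR_le_abs_mult:
  fixes x :: "'a::banach_lattice"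
  shows "r *\<^sub>R x \<le> \<bar>r\<bar> *\<^sub>R \<bar>x\<bar>"
proof (cases "0 \<le> r")
  case True
  then show ?thesis by (simp add: scaleR_left_mono abs_ge_self)
next
  case False
  then have "(- r) *\<^sub>R (- x) \<le> (- r) *\<^sub>R \<bar>x\<bar>"
    using abs_ge_minus_self by (intro scaleR_left_mono) auto
  then show ?thesis using False by simp
qed

lemma modulus_ex:
  fixes x y :: "'a::banach_lattice"
  shows "\<exists>m. (\<forall>\<theta>. cos \<theta> *\<^sub>R x + sin \<theta> *\<^sub>R y \<le> m) \<and>
     (\<forall>u. (\<forall>\<theta>. cos \<theta> *\<^sub>R x + sin \<theta> *\<^sub>R y \<le> u) \<longrightarrow> m \<le> u)"
proof -
  define f where "f c = Re c *\<^sub>R x + Im c *\<^sub>R y" for c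
  define w where "w = \<bar>x\<bar> + \<bar>y\<bar>"
  have w0: "0 \<le> w" by (simp add: w_def)
  have f_cis: "f (cis \<theta>) = cos \<theta> *\<^sub>R x + sin \<theta> *\<^sub>R y" for \<theta>
    by (simp add: f_def)
  have sphere: "\<exists>\<theta>. c = cis \<theta>" if "cmod c = 1" for c
  proof -
    have "cis (Arg c) = c"
      using that rcis_cmod_Arg[of c] by (simp add: rcis_def)
    then show ?thesis by metis
  qed
  have lip: "f c \<le> f d + e *\<^sub>R w" if "cmod (c - d) \<le> e" for c d e
  proof -
    have "f c - f d = (Re (c - d)) *\<^sub>R x + (Im (c - d)) *\<^sub>R y"
      by (simp add: f_def algebra_simps)
    also have "\<dots> \<le> \<bar>Re (c - d)\<bar> *\<^sub>R \<bar>x\<bar> + \<bar>Im (c - d)\<bar> *\<^sub>R \<bar>y\<bar>"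
      by (intro add_mono scaleR_le_abs_mult)
    also have "\<dots> \<le> e *\<^sub>R \<bar>x\<bar> + e *\<^sub>R \<bar>y\<bar>"
      using that abs_Re_le_cmod[of "c - d"] abs_Im_le_cmod[of "c - d"]
      by (intro add_mono scaleR_right_mono abs_ge_zero) linarith+
    finally show ?thesis by (simp add: w_def algebra_simps)
  qed
  have net: "\<exists>A. finite A \<and> A \<noteq> {} \<and> A \<subseteq> sphere (0::complex) 1 \<and> sphere 0 1 \<subseteq> (\<Union>a\<in>A. ball a e)"
    if "e > 0" for e :: real
  proof -
    have "seq_compact (sphere (0::complex) 1)"
      by (intro compact_imp_seq_compact) simp
    from seq_compact_imp_totally_bounded[OF this] \<open>e > 0\<close>
    obtain A where "finite A" "A \<subseteq> sphere 0 1" "sphere (0::complex) 1 \<subseteq> (\<Union>a\<in>A. ball a e)"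
      by meson
    moreover have "(1::complex) \<in> sphere 0 1" by simp
    ultimately show ?thesis by (intro exI[of _ A]) auto
  qed
  define e where "e n = 1 / real (Suc n)" for n
  have e_pos: "e n > 0" for n by (simp add: e_def)
  define A where "A n = (SOME A. finite A \<and> A \<noteq> {} \<and> A \<subseteq> sphere (0::complex) 1 \<and>
    sphere 0 1 \<subseteq> (\<Union>a\<in>A. ball a (e n)))" for n
  have "finite (A n) \<and> A n \<noteq> {} \<and> A n \<subseteq> sphere (0::complex) 1 \<and>
    sphere 0 1 \<subseteq> (\<Union>a\<in>A n. ball a (e n))" for n
    unfolding A_def by (rule someI_ex) (rule net[OF e_pos])
  then have A: "finite (A n)" "A n \<noteq> {}" "A n \<subseteq> sphere 0 1"
    "sphere 0 1 \<subseteq> (\<Union>a\<in>A n. ball a (e n))" for n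
    by simp_all
  define s where "s n = Sup_fin (f ` A n)" for n
  have f_le: "f c \<le> s n + e n *\<^sub>R w" if c: "cmod c = 1" for c n
  proof -
    obtain a where a: "a \<in> A n" "dist a c < e n"
      using subsetD[OF A(4)[of n], of c] c by auto
    have "f c \<le> f a + e n *\<^sub>R w"
      using a(2) by (intro lip) (simp add: dist_norm norm_minus_commute)
    moreover have "f a \<le> s n"
      unfolding s_def using a(1) A(1) by (intro Sup_fin.coboundedI) auto
    ultimately show ?thesis by (meson add_right_mono order_trans)
  qed
  have s_le: "s n \<le> u" if "\<And>c. cmod c = 1 \<Longrightarrow> f c \<le> u" for n u
    proof -
    have "a \<le> u" if a: "a \<in> f ` A n" for a
    proof -
      obtain c where "c \<in> A n" "a = f c" using a by blast
      moreover have "cmod c = 1" using A(3)[of n] \<open>c \<in> A n\<close> by auto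
      ultimately show ?thesis using \<open>\<And>c. cmod c = 1 \<Longrightarrow> f c \<le> u\<close> by blast
    qed
    then show ?thesis
      unfolding s_def using A(1,2)[of n] by (intro Sup_fin.boundedI) auto
  qed
  have s_diff: "s m \<le> s n + e n *\<^sub>R w" for m n
    by (intro s_le f_le)
  have e_lim: "e \<longlonglongrightarrow> 0"
    unfolding e_def using LIMSEQ_inverse_real_of_nat by (simp add: inverse_eq_divide)
  have norm_s: "norm (s m - s n) \<le> (e m + e n) * norm w" for m n
  proof -
    have "e n *\<^sub>R w \<le> (e m + e n) *\<^sub>R w" "e m *\<^sub>R w \<le> (e m + e n) *\<^sub>R w"
      using e_pos[of m] e_pos[of n] w0 by (auto intro!: scaleR_right_mono)
    moreover have "s m - s n \<le> e n *\<^sub>R w" "- (s m - s n) \<le> e m *\<^sub>R w"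
      using s_diff[of m n] s_diff[of n m] by (simp_all add: algebra_simps)
    ultimately have "\<bar>s m - s n\<bar> \<le> (e m + e n) *\<^sub>R w"
      by (intro abs_leI) (blast intro: order_trans)+
    then have "norm \<bar>s m - s n\<bar> \<le> norm ((e m + e n) *\<^sub>R w)"
      by (intro norm_mono_pos) auto
    then show ?thesis
      using e_pos[of m] e_pos[of n] by (simp add: norm_abs_lattice)
  qed
  have "Cauchy s"
  proof (rule metric_CauchyI)
    fix r :: real assume "r > 0"
    have "(\<lambda>n. e n * norm w) \<longlonglongrightarrow> 0" using tendsto_mult_left_zero[OF e_lim] .
    then have "eventually (\<lambda>n. e n * norm w < r / 2) sequentially"
      using \<open>r > 0\<close> by (intro order_tendstoD(2)) auto
    then obtain N where N: "\<And>n. n \<ge> N \<Longrightarrow> e n * norm w < r / 2"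
      by (auto simp: eventually_sequentially)
    show "\<exists>M. \<forall>m\<ge>M. \<forall>n\<ge>M. dist (s m) (s n) < r"
    proof (intro exI[of _ N] allI impI)
      fix m n assume "N \<le> m" "N \<le> n"
      then show "dist (s m) (s n) < r"
        using N[of m] N[of n] norm_s[of m n] unfolding dist_norm distrib_right by linarith
    qed
  qed
  then obtain m where m: "s \<longlonglongrightarrow> m"
    using Cauchy_convergent convergent_def by blast
  have "(\<lambda>n. s n + e n *\<^sub>R w) \<longlonglongrightarrow> m + 0 *\<^sub>R w"
    by (intro tendsto_intros m e_lim)
  then have lim: "(\<lambda>n. s n + e n *\<^sub>R w) \<longlonglongrightarrow> m" by simp
  show ?thesis
  proof (intro exI[of _ m] conjI allI impI)
    fix \<theta> :: real
    have "f (cis \<theta>) \<le> m"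
      by (rule LIMSEQ_le_lattice[OF tendsto_const lim]) (simp add: f_le)
    then show "cos \<theta> *\<^sub>R x + sin \<theta> *\<^sub>R y \<le> m" by (simp add: f_cis)
  next
    fix u assume u: "\<forall>\<theta>. cos \<theta> *\<^sub>R x + sin \<theta> *\<^sub>R y \<le> u"
    have "f c \<le> u" if "cmod c = 1" for c
    proof -
      obtain \<theta> where "c = cis \<theta>" using sphere \<open>cmod c = 1\<close> by blast
      then show ?thesis using u by (simp add: f_cis)
    qed
    then have "s n \<le> u" for n by (rule s_le)
    then show "m \<le> u"
      by (intro LIMSEQ_le_lattice[OF m tendsto_const])
  qed
qed

lemma modulus_lub:
  "(\<forall>\<theta>. cos \<theta> *\<^sub>R re_part z + sin \<theta> *\<^sub>R im_part z \<le> modulus z) \<and>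
   (\<forall>u. (\<forall>\<theta>. cos \<theta> *\<^sub>R re_part z + sin \<theta> *\<^sub>R im_part z \<le> u) \<longrightarrow> modulus z \<le> u)"
  unfolding modulus_def
  by (rule theI') (intro ex_ex1I modulus_ex, blast intro: antisym)

lemma modulus_upper: "cos \<theta> *\<^sub>R re_part z + sin \<theta> *\<^sub>R im_part z \<le> modulus z"
  using modulus_lub by blast

lemma modulus_least:
  "(\<And>\<theta>. cos \<theta> *\<^sub>R re_part z + sin \<theta> *\<^sub>R im_part z \<le> u) \<Longrightarrow> modulus z \<le> u"
  using modulus_lub by blast

lemma abs_re_le_modulus: "\<bar>re_part z\<bar> \<le> modulus z"
  using modulus_upper[of 0 z] modulus_upper[of pi z] by (intro abs_leI) simp_all

lemma abs_im_le_modulus: "\<bar>im_part z\<bar> \<le> modulus z"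
  using modulus_upper[of "pi/2" z] modulus_upper[of "-(pi/2)" z] by (intro abs_leI) simp_all

lemma modulus_nonneg [simp]: "0 \<le> modulus z"
  using abs_re_le_modulus[of z] abs_ge_zero order_trans by blast

lemma abs_modulus [simp]: "\<bar>modulus z\<bar> = modulus z"
  by (rule abs_of_nonneg) simp

lemma modulus_le_sum: "modulus z \<le> \<bar>re_part z\<bar> + \<bar>im_part z\<bar>"
proof (rule modulus_least)
  fix \<theta> :: real
  have "cos \<theta> *\<^sub>R re_part z + sin \<theta> *\<^sub>R im_part z \<le> \<bar>cos \<theta>\<bar> *\<^sub>R \<bar>re_part z\<bar> + \<bar>sin \<theta>\<bar> *\<^sub>R \<bar>im_part z\<bar>"
    by (intro add_mono scaleR_le_abs_mult)
  also have "\<dots> \<le> 1 *\<^sub>R \<bar>re_part z\<bar> + 1 *\<^sub>R \<bar>im_part z\<bar>"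
    by (intro add_mono scaleR_right_mono) auto
  finally show "cos \<theta> *\<^sub>R re_part z + sin \<theta> *\<^sub>R im_part z \<le> \<bar>re_part z\<bar> + \<bar>im_part z\<bar>"
    by simp
qed

lemma modulus_complexify [simp]: "modulus (complexify x) = \<bar>x\<bar>"
  using modulus_le_sum[of "complexify x"] abs_re_le_modulus[of "complexify x"]
  by (intro antisym) simp_all

lemma modulus_eq_0_iff: "modulus z = 0 \<longleftrightarrow> z = 0"
proof
  assume "modulus z = 0"
  then show "z = 0"
    using abs_re_le_modulus[of z] abs_im_le_modulus[of z] by (simp add: cplx_eq_iff)
next
  assume "z = 0"
  then have "modulus z \<le> 0" using modulus_le_sum[of z] by simp
  then show "modulus z = 0" by (simp add: antisym)
qed

lemma modulus_triangle: "modulus (z + w) \<le> modulus z + modulus w"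
proof (rule modulus_least)
  fix \<theta>
  show "cos \<theta> *\<^sub>R re_part (z + w) + sin \<theta> *\<^sub>R im_part (z + w) \<le> modulus z + modulus w"
    using add_mono[OF modulus_upper[of \<theta> z] modulus_upper[of \<theta> w]]
    by (simp add: algebra_simps)
qed

lemma modulus_scaleC_le:
  fixes z :: "'a::banach_lattice complexification"
  shows "modulus (c *\<^sub>C z) \<le> cmod c *\<^sub>R modulus z"
proof (rule modulus_least)
  fix \<theta>
  have c: "Re c = cmod c * cos (Arg c)" "Im c = cmod c * sin (Arg c)"
    by (metis Re_rcis rcis_cmod_Arg, metis Im_rcis rcis_cmod_Arg)
  have "cos \<theta> *\<^sub>R re_part (c *\<^sub>C z) + sin \<theta> *\<^sub>R im_part (c *\<^sub>C z) =
    (cos \<theta> * Re c + sin \<theta> * Im c) *\<^sub>R re_part z + (sin \<theta> * Re c - cos \<theta> * Im c) *\<^sub>R im_part z"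
    by (simp add: algebra_simps)
  also have "\<dots> = cmod c *\<^sub>R (cos (\<theta> - Arg c) *\<^sub>R re_part z + sin (\<theta> - Arg c) *\<^sub>R im_part z)"
    unfolding c cos_diff sin_diff by (simp add: algebra_simps)
  also have "\<dots> \<le> cmod c *\<^sub>R modulus z"
    by (intro scaleR_left_mono modulus_upper) simp
  finally show "cos \<theta> *\<^sub>R re_part (c *\<^sub>C z) + sin \<theta> *\<^sub>R im_part (c *\<^sub>C z) \<le> cmod c *\<^sub>R modulus z" .
qed

lemma scaleC_scaleC_cplx: "a *\<^sub>C b *\<^sub>C z = (a * b) *\<^sub>C (z :: 'a::real_vector complexification)"
  by (simp add: cplx_eq_iff algebra_simps)

lemma scaleC_of_real_cplx:
  "complex_of_real r *\<^sub>C z = r *\<^sub>R (z :: 'a::real_vector complexification)"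
  by (simp add: cplx_eq_iff)

lemma modulus_scaleC:
  fixes z :: "'a::banach_lattice complexification"
  shows "modulus (c *\<^sub>C z) = cmod c *\<^sub>R modulus z"
proof (cases "c = 0")
  case True
  have "(0::complex) *\<^sub>C z = 0" by (simp add: cplx_eq_iff)
  then show ?thesis using True by (simp add: modulus_eq_0_iff)
next
  case False
  have "z = inverse c *\<^sub>C c *\<^sub>C z"
    using False scaleC_of_real_cplx[of 1 z] by (simp add: scaleC_scaleC_cplx)
  then have "modulus z \<le> cmod (inverse c) *\<^sub>R modulus (c *\<^sub>C z)"
    by (metis modulus_scaleC_le)
  then have "cmod c *\<^sub>R modulus z \<le> cmod c *\<^sub>R cmod (inverse c) *\<^sub>R modulus (c *\<^sub>C z)"
    by (intro scaleR_left_mono) auto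
  then have "cmod c *\<^sub>R modulus z \<le> modulus (c *\<^sub>C z)"
    using False by (simp add: norm_inverse)
  then show ?thesis using modulus_scaleC_le by (intro antisym)
qed


subsection \<open>Norm and absolute value on the complexification\<close>

instantiation complexification :: (banach_lattice) abs
begin

definition abs_complexification :: "'a complexification \<Rightarrow> 'a complexification" where
  "\<bar>z\<bar> = complexify (modulus z)"

instance ..

end

instantiation complexification :: (banach_lattice) real_normed_vector
begin

definition norm_complexification :: "'a complexification \<Rightarrow> real" where
  "norm z = norm (modulus z)"

definition dist_complexification :: "'a complexification \<Rightarrow> 'a complexification \<Rightarrow> real" where
  "dist_complexification z w = norm (z - w)"

definition sgn_complexification :: "'a complexification \<Rightarrow> 'a complexification" where
  "sgn_complexification z = z /\<^sub>R norm z"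

definition uniformity_complexification :: "('a complexification \<times> 'a complexification) filter" where
  "uniformity_complexification = (INF e\<in>{0 <..}. principal {(z, w). dist z w < e})"

definition open_complexification :: "'a complexification set \<Rightarrow> bool" where
  "open_complexification U \<longleftrightarrow> (\<forall>z\<in>U. eventually (\<lambda>(z', w). z' = z \<longrightarrow> w \<in> U) uniformity)"

instance
proof
  fix z w :: "'a complexification" and r :: real
  show "norm z = 0 \<longleftrightarrow> z = 0"
    by (simp add: norm_complexification_def modulus_eq_0_iff)
  have "norm (modulus (z + w)) \<le> norm (modulus z + modulus w)"
    by (intro norm_mono_pos modulus_triangle) simp
  then show "norm (z + w) \<le> norm z + norm w"
    unfolding norm_complexification_def by (rule order_trans) (rule norm_triangle_ineq)
  show "norm (r *\<^sub>R z) = \<bar>r\<bar> * norm z"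
    unfolding norm_complexification_def scaleC_of_real_cplx[symmetric] modulus_scaleC by simp
qed (simp_all add: dist_complexification_def sgn_complexification_def
      uniformity_complexification_def open_complexification_def)

end

lemma norm_re_part_le: "norm (re_part z) \<le> norm (z :: 'a::banach_lattice complexification)"
  unfolding norm_complexification_def
  by (rule norm_mono) (simp add: abs_re_le_modulus)

lemma norm_im_part_le: "norm (im_part z) \<le> norm (z :: 'a::banach_lattice complexification)"
  unfolding norm_complexification_def
  by (rule norm_mono) (simp add: abs_im_le_modulus)

lemma norm_cplx_le:
  fixes z :: "'a::banach_lattice complexification"
  shows "norm z \<le> norm (re_part z) + norm (im_part z)"
proof -
  have "norm (modulus z) \<le> norm (\<bar>re_part z\<bar> + \<bar>im_part z\<bar>)"
    by (intro norm_mono_pos modulus_le_sum) simp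
  also have "\<dots> \<le> norm \<bar>re_part z\<bar> + norm \<bar>im_part z\<bar>" by (rule norm_triangle_ineq)
  finally show ?thesis by (simp add: norm_complexification_def norm_abs_lattice)
qed

instance complexification :: (banach_lattice) complex_banach
proof
  fix X :: "nat \<Rightarrow> 'a complexification"
  assume "Cauchy X"
  have "Cauchy (\<lambda>n. re_part (X n))" "Cauchy (\<lambda>n. im_part (X n))"
    using \<open>Cauchy X\<close> norm_re_part_le[of "X _ - X _"] norm_im_part_le[of "X _ - X _"]
    unfolding Cauchy_def dist_norm minus_complexification.simps
    by (meson le_less_trans)+
  then obtain x y where "(\<lambda>n. re_part (X n)) \<longlonglongrightarrow> x" "(\<lambda>n. im_part (X n)) \<longlonglongrightarrow> y"
    using Cauchy_convergent unfolding convergent_def by metis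
  then have "(\<lambda>n. norm (re_part (X n) - x) + norm (im_part (X n) - y)) \<longlonglongrightarrow> 0"
    by (simp add: LIM_zero tendsto_norm_zero tendsto_add_zero)
  moreover have "norm (X n - Cplx x y) \<le> norm (re_part (X n) - x) + norm (im_part (X n) - y)" for n
    using norm_cplx_le[of "X n - Cplx x y"] by simp
  ultimately have "(\<lambda>n. norm (X n - Cplx x y)) \<longlonglongrightarrow> 0"
    by (rule_tac Lim_null_comparison) auto
  then have "X \<longlonglongrightarrow> Cplx x y"
    by (simp add: LIM_zero_cancel tendsto_norm_zero_iff)
  then show "convergent X"
    by (auto simp: convergent_def)
next
  fix a b :: complex and z w :: "'a complexification"
  show "a *\<^sub>C (z + w) = a *\<^sub>C z + a *\<^sub>C w" "(a + b) *\<^sub>C z = a *\<^sub>C z + b *\<^sub>C z"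
    by (simp_all add: cplx_eq_iff algebra_simps)
  show "norm (a *\<^sub>C z) = cmod a * norm z"
    by (simp add: norm_complexification_def modulus_scaleC)
qed (simp_all only: scaleC_scaleC_cplx scaleC_of_real_cplx)


section \<open>Positive and dominated operators\<close>

definition positive_operator ::
  "('a::banach_lattice complexification \<Rightarrow> 'b::banach_lattice complexification) \<Rightarrow> bool" where
  "positive_operator T \<longleftrightarrow> bounded_clinear T \<and> (\<forall>z. 0 \<le> z \<longrightarrow> 0 \<le> T z)"

definition dominates ::
  "('a::banach_lattice complexification \<Rightarrow> 'b::banach_lattice complexification) \<Rightarrow>
   ('a complexification \<Rightarrow> 'b complexification) \<Rightarrow> bool" where
  "dominates T S \<longleftrightarrow> (\<forall>z. \<bar>S z\<bar> \<le> T \<bar>z\<bar>)"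

end

theory Submission
  imports Defs
begin

text \<open>
  In an atomic Banach lattice with order continuous norm the projections \<open>P\<close> onto the spans of finitely
  many atoms satisfy \<open>0 \<le> P \<le> I\<close> and converge strongly to \<open>I\<close>, so \<open>\<chi>(T)\<close> is the infimum of
  \<open>\<parallel>(I - P) T\<parallel>\<close>. As \<open>I - P\<close> is positive, \<open>\<chi>\<close> is monotone under domination, which is (3).

  Let \<open>\<rho>(T)\<close> be the infimum of the numbers \<open>\<chi>(T\<^sup>n)\<close> to the power \<open>1/n\<close>. If \<open>\<chi>(S\<^sup>m) < \<bar>c\<bar>\<^sup>m\<close>, then \<open>S\<^sup>m\<close> is a compact
  perturbation of an operator of norm less than \<open>\<bar>c\<bar>\<^sup>m\<close>, so \<open>c - S\<close> is invertible modulo compact operators;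
  hence \<open>r\<^sub>e\<^sub>s\<^sub>s(S) \<le> \<rho>(S)\<close>. For positive \<open>T\<close> on an infinite-dimensional space \<open>\<rho> = \<rho>(T)\<close> lies in the
  essential spectrum, without any appeal to the spectral radius formula: if \<open>\<rho> - T\<close> had an inverse \<open>Q\<close> modulo
  compact operators, the partial sums \<open>X\<^sub>n\<close> of the series of \<open>T\<^sup>k / \<lambda>\<^sup>k\<^sup>+\<^sup>1\<close> would satisfy
  \<open>\<chi>(X\<^sub>n) \<le> 4 \<chi>(Q)\<close> for all \<open>n\<close> and all \<open>\<lambda> > \<rho>\<close> close to \<open>\<rho>\<close>. Since \<open>X\<^sub>k\<^sub>+\<^sub>1\<^sup>2\<close> dominates
  \<open>(k + 1) T\<^sup>k / \<lambda>\<^sup>k\<^sup>+\<^sup>2\<close>, this gives \<open>(k + 1) \<chi>(T\<^sup>k) \<le> 16 \<chi>(Q)\<^sup>2 \<rho>\<^sup>k\<^sup>+\<^sup>2\<close> in the limit, contradicting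
  \<open>\<chi>(T\<^sup>k) \<ge> \<rho>\<^sup>k\<close> for large \<open>k\<close>.
\<close>


section \<open>Coordinates with respect to an atom\<close>

text \<open>For an atom \<open>a\<close> and \<open>x \<ge> 0\<close> this is the coefficient of the
  component of \<open>x\<close> along \<open>a\<close>, namely the largest multiple of
  \<open>a\<close> below \<open>x\<close>. It is evaluated at nonnegative vectors only.\<close>

definition poscoord :: "'a::banach_lattice \<Rightarrow> 'a \<Rightarrow> real" where
  "poscoord a x = Sup {r. r *\<^sub>R a \<le> x}"

text \<open>The library takes \<open>nprt x\<close> to be nonpositive, so \<open>- nprt x\<close> is
  the usual negative part, and the definition extends the coefficient from the cone by
  differences.\<close>

definition coord :: "'a::banach_lattice \<Rightarrow> 'a \<Rightarrow> real" where
  "coord a x = poscoord a (pprt x) - poscoord a (- nprt x)"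

lemma atom_pos: "atom a \<Longrightarrow> 0 < a" and atom_nonneg: "atom a \<Longrightarrow> 0 \<le> (a::'a::banach_lattice)"
  by (auto simp: atom_def)

lemma scaleR_le_scaleR_imp_le:
  fixes a :: "'a::banach_lattice"
  assumes "0 < a" "r *\<^sub>R a \<le> s *\<^sub>R a"
  shows "r \<le> s"
proof (rule ccontr)
  assume "\<not> r \<le> s"
  then have "(r - s) *\<^sub>R a \<le> 0" "0 < r - s"
    using assms(2) by (simp_all add: algebra_simps)
  then have "a \<le> 0"
    by (metis eucl_less_le_not_le scaleR_le_0_iff order.strict_iff_not)
  then show False using assms(1) by simp
qed

lemma poscoord_set_props:
  fixes a :: "'a::banach_lattice"
  assumes "0 < a" "0 \<le> x"
  shows "bdd_above {r. r *\<^sub>R a \<le> x}" "{r. r *\<^sub>R a \<le> x} \<noteq> {}"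
proof -
  have na: "norm a > 0" using assms by simp
  have "r \<le> norm x / norm a" if "r *\<^sub>R a \<le> x" for r
  proof (cases "r \<le> 0")
    case True
    then show ?thesis using na by (meson divide_nonneg_pos norm_ge_zero order_trans)
  next
    case False
    then have "norm (r *\<^sub>R a) \<le> norm x"
      using that assms by (intro norm_mono_pos) (auto simp: scaleR_nonneg_nonneg)
    then show ?thesis using False na by (simp add: field_simps)
  qed
  then show "bdd_above {r. r *\<^sub>R a \<le> x}" by (intro bdd_aboveI[of _ "norm x / norm a"]) auto
  show "{r. r *\<^sub>R a \<le> x} \<noteq> {}" using assms(2) by (auto intro!: exI[of _ 0])
qed

lemma poscoord_upper: "0 < a \<Longrightarrow> 0 \<le> x \<Longrightarrow> r *\<^sub>R a \<le> x \<Longrightarrow> r \<le> poscoord a x"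
  unfolding poscoord_def by (rule cSup_upper) (auto intro: poscoord_set_props)

lemma poscoord_nonneg: "0 < a \<Longrightarrow> 0 \<le> x \<Longrightarrow> 0 \<le> poscoord a x"
  by (rule poscoord_upper) auto

text \<open>The supremum is attained because the positive cone is norm closed: multiples of
  \<open>a\<close> slightly below the supremum lie under \<open>x\<close>, and the inequality
  survives the limit.\<close>

lemma poscoord_scaleR_le:
  assumes "0 < a" "0 \<le> x"
  shows "poscoord a x *\<^sub>R a \<le> x"
proof (rule LIMSEQ_le_lattice[OF _ tendsto_const])
  define X where "X n = (poscoord a x - inverse (real (Suc n))) *\<^sub>R a" for n
  have "X \<longlonglongrightarrow> (poscoord a x - 0) *\<^sub>R a"
    unfolding X_def by (intro tendsto_intros LIMSEQ_inverse_real_of_nat)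
  then show "X \<longlonglongrightarrow> poscoord a x *\<^sub>R a" by simp
  fix n
  have "poscoord a x - inverse (real (Suc n)) < poscoord a x" by simp
  then obtain r where r: "r *\<^sub>R a \<le> x" "poscoord a x - inverse (real (Suc n)) < r"
    using less_cSup_iff[OF poscoord_set_props(2,1)[OF assms]] unfolding poscoord_def by auto
  have "X n \<le> r *\<^sub>R a"
    unfolding X_def using assms(1) r(2) by (intro scaleR_right_mono) auto
  then show "X n \<le> x" using r(1) by (rule order_trans)
qed

text \<open>The definition of an atom speaks of the interval from \<open>0\<close> to
  \<open>a\<close> only; rescaling by \<open>inverse r\<close> reduces to it.\<close>

lemma atom_interval:
  assumes "atom a" "0 \<le> x" "x \<le> r *\<^sub>R a" "0 \<le> r"
  shows "\<exists>s. x = s *\<^sub>R a"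
proof (cases "r = 0")
  case True
  then have "x = 0" using assms by simp
  then show ?thesis by (intro exI[of _ 0]) simp
next
  case False
  then have r: "0 < r" using assms by simp
  have "inverse r *\<^sub>R x \<le> inverse r *\<^sub>R (r *\<^sub>R a)"
    using r assms by (intro scaleR_left_mono) auto
  then have "inverse r *\<^sub>R x \<le> a" using r by simp
  moreover have "0 \<le> inverse r *\<^sub>R x" using r assms by (simp add: scaleR_nonneg_nonneg)
  ultimately obtain s where "inverse r *\<^sub>R x = s *\<^sub>R a"
    using assms(1) unfolding atom_def by blast
  then have "r *\<^sub>R inverse r *\<^sub>R x = r *\<^sub>R s *\<^sub>R a" by simp
  then show ?thesis using r by (intro exI[of _ "r * s"]) simp
qed

text \<open>Subadditivity is Riesz decomposition: if \<open>r *\<^sub>R a\<close> lies below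
  \<open>x + y\<close>, then \<open>u = inf (r *\<^sub>R a) x\<close> lies below \<open>x\<close>
  and the rest below \<open>y\<close>, and the atom property makes \<open>u\<close> a multiple of
  \<open>a\<close>. Superadditivity just adds the two multiples.\<close>

lemma poscoord_add:
  assumes "atom a" "0 \<le> x" "0 \<le> y"
  shows "poscoord a (x + y) = poscoord a x + poscoord a y"
proof (rule antisym)
  have a: "0 < a" using assms atom_pos by blast
  define r where "r = poscoord a (x + y)"
  have r: "r *\<^sub>R a \<le> x + y" "0 \<le> r"
    using poscoord_scaleR_le[OF a, of "x + y"] poscoord_nonneg[OF a, of "x + y"] assms
    by (simp_all add: r_def)
  define u where "u = inf (r *\<^sub>R a) x"
  have ra: "0 \<le> r *\<^sub>R a" using a r by (simp add: scaleR_nonneg_nonneg)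
  have u: "0 \<le> u" "u \<le> r *\<^sub>R a" "u \<le> x"
    using assms ra by (auto simp: u_def)
  have "r *\<^sub>R a - y \<le> u"
    using r assms by (auto simp: u_def algebra_simps)
  then have v: "r *\<^sub>R a - u \<le> y" by (simp add: algebra_simps)
  obtain s where s: "u = s *\<^sub>R a" using atom_interval[OF assms(1) u(1,2) r(2)] by blast
  have "s \<le> poscoord a x" using poscoord_upper[OF a assms(2)] u(3) s by simp
  moreover have "r - s \<le> poscoord a y"
    using poscoord_upper[OF a assms(3), of "r - s"] v s by (simp add: algebra_simps)
  ultimately show "poscoord a (x + y) \<le> poscoord a x + poscoord a y" by (simp add: r_def)
next
  have a: "0 < a" using assms atom_pos by blast
  have "(poscoord a x + poscoord a y) *\<^sub>R a \<le> x + y"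
    using poscoord_scaleR_le[OF a] assms by (simp add: scaleR_add_left add_mono)
  then show "poscoord a x + poscoord a y \<le> poscoord a (x + y)"
    using a assms by (intro poscoord_upper) auto
qed

lemma poscoord_scale_le:
  assumes "0 < a" "0 \<le> x" "0 < r"
  shows "r * poscoord a x \<le> poscoord a (r *\<^sub>R x)"
proof (rule poscoord_upper[OF assms(1)])
  show "0 \<le> r *\<^sub>R x" using assms by (simp add: scaleR_nonneg_nonneg)
  show "(r * poscoord a x) *\<^sub>R a \<le> r *\<^sub>R x"
    using scaleR_left_mono[OF poscoord_scaleR_le[OF assms(1,2)], of r] assms by simp
qed

lemma poscoord_zero: "0 < a \<Longrightarrow> poscoord a 0 = 0"
  by (metis antisym order_refl poscoord_nonneg poscoord_scaleR_le scaleR_le_scaleR_imp_le scaleR_zero_left)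

lemma poscoord_scale:
  assumes "0 < a" "0 \<le> x" "0 \<le> r"
  shows "poscoord a (r *\<^sub>R x) = r * poscoord a x"
proof (cases "r = 0")
  case False
  then have r: "0 < r" using assms by simp
  have "inverse r * poscoord a (r *\<^sub>R x) \<le> poscoord a (inverse r *\<^sub>R (r *\<^sub>R x))"
    using assms r by (intro poscoord_scale_le) (auto simp: scaleR_nonneg_nonneg)
  then have "poscoord a (r *\<^sub>R x) \<le> r * poscoord a x" using r by (simp add: field_simps)
  then show ?thesis using poscoord_scale_le[OF assms(1,2) r] by simp
qed (simp add: poscoord_zero assms)

section \<open>Linearity of the coordinate on the whole lattice\<close>

lemma coord_diff_pos:
  assumes "atom a" "0 \<le> u" "0 \<le> v"
  shows "coord a (u - v) = poscoord a u - poscoord a v"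
proof -
  have n: "0 \<le> pprt (u - v)" "0 \<le> - nprt (u - v)" by simp_all
  \<comment> \<open>Two ways of writing one vector as a difference of positive vectors are compared
    as sums of positive vectors, where additivity on the cone applies.\<close>
  have "pprt (u - v) + v = u + (- nprt (u - v))"
    using prts[of "u - v"] by (simp add: algebra_simps)
  then have "poscoord a (pprt (u - v)) + poscoord a v = poscoord a u + poscoord a (- nprt (u - v))"
    using poscoord_add[OF assms(1)] n assms by metis
  then show ?thesis by (simp add: coord_def)
qed

lemma coord_nonneg_eq: "atom a \<Longrightarrow> 0 \<le> x \<Longrightarrow> coord a x = poscoord a x"
  using coord_diff_pos[of a x 0] by (simp add: poscoord_zero atom_pos)

text \<open>Negatives, nonnegative multiples and sums are each written as differences of positive
  vectors, which reduces everything to the cone.\<close>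

lemma linear_coord:
  assumes "atom a"
  shows "linear (coord a)"
proof (rule linearI)
  have a: "0 < a" using assms atom_pos by blast
  have minus: "coord a (- x) = - coord a x" for x
  proof -
    have "- x = - nprt x - pprt x" using prts[of x] by (simp add: algebra_simps)
    then show ?thesis
      using coord_diff_pos[OF assms, of "- nprt x" "pprt x"]
      by (simp only: coord_def[of a x]) simp
  qed
  have pos: "coord a (r *\<^sub>R x) = r * coord a x" if "0 \<le> r" for r x
  proof -
    have "r *\<^sub>R x = r *\<^sub>R pprt x - r *\<^sub>R (- nprt x)"
      using prts[of x] by (metis diff_minus_eq_add scaleR_add_right scaleR_minus_right)
    then have "coord a (r *\<^sub>R x) = poscoord a (r *\<^sub>R pprt x) - poscoord a (r *\<^sub>R (- nprt x))"
      using that coord_diff_pos[OF assms, of "r *\<^sub>R pprt x" "r *\<^sub>R (- nprt x)"]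
      by (metis neg_0_le_iff_le nprt_le_zero scaleR_nonneg_nonneg zero_le_pprt)
    then show ?thesis
      using that a by (simp add: poscoord_scale coord_def algebra_simps del: scaleR_minus_right)
  qed
  show "coord a (x + y) = coord a x + coord a y" for x y
  proof -
    have "x + y = (pprt x + pprt y) - (- nprt x + - nprt y)"
      using arg_cong2[OF prts[of x] prts[of y], of "(+)"] by (simp add: algebra_simps)
    then have "coord a (x + y) = poscoord a (pprt x + pprt y) - poscoord a (- nprt x + - nprt y)"
      using coord_diff_pos[OF assms, of "pprt x + pprt y" "- nprt x + - nprt y"]
      by (metis add_nonneg_nonneg neg_0_le_iff_le nprt_le_zero zero_le_pprt)
    then show ?thesis
      using poscoord_add[OF assms, of "pprt x" "pprt y"]
        poscoord_add[OF assms, of "- nprt x" "- nprt y"] by (simp add: coord_def)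
  qed
  show "coord a (r *\<^sub>R x) = r *\<^sub>R coord a x" for r x
    using pos[of r x] pos[of "- r" x] minus[of "r *\<^sub>R x"] by (cases "0 \<le> r") auto
qed

lemma coord_nonneg: "atom a \<Longrightarrow> 0 \<le> x \<Longrightarrow> 0 \<le> coord a x"
  by (simp add: coord_nonneg_eq poscoord_nonneg atom_pos)

lemma coord_scaleR_le: "atom a \<Longrightarrow> 0 \<le> x \<Longrightarrow> coord a x *\<^sub>R a \<le> x"
  by (simp add: coord_nonneg_eq poscoord_scaleR_le atom_pos)

lemma coord_upper: "atom a \<Longrightarrow> 0 \<le> x \<Longrightarrow> r *\<^sub>R a \<le> x \<Longrightarrow> r \<le> coord a x"
  by (simp add: coord_nonneg_eq poscoord_upper atom_pos)

lemma coord_self: "atom a \<Longrightarrow> coord a a = 1"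
  using coord_scaleR_le[of a a] coord_upper[of a a 1] scaleR_le_scaleR_imp_le[of a "coord a a" 1]
  by (simp add: atom_pos atom_nonneg)

text \<open>A nonzero coordinate would put a positive multiple of \<open>a\<close> into the interval
  from \<open>0\<close> to \<open>b\<close>; since \<open>b\<close> is an atom, \<open>a\<close> and
  \<open>b\<close> are then proportional, and equal norms make them equal.\<close>

lemma coord_other:
  assumes "atom a" "atom b" "norm a = 1" "norm b = 1" "a \<noteq> b"
  shows "coord a b = 0"
proof (rule ccontr)
  assume "coord a b \<noteq> 0"
  moreover have n: "0 \<le> coord a b" using assms by (intro coord_nonneg atom_nonneg)
  ultimately have p: "0 < coord a b" by simp
  have "coord a b *\<^sub>R a \<le> 1 *\<^sub>R b" using coord_scaleR_le[OF assms(1) atom_nonneg[OF assms(2)]] by simp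
  moreover have "0 \<le> coord a b *\<^sub>R a" using n assms atom_nonneg scaleR_nonneg_nonneg by blast
  ultimately obtain s where s: "coord a b *\<^sub>R a = s *\<^sub>R b"
    using atom_interval[OF assms(2)] by fastforce
  have "0 \<le> s"
    using s \<open>0 \<le> coord a b *\<^sub>R a\<close> scaleR_le_scaleR_imp_le[OF atom_pos[OF assms(2)], of 0 s] by simp
  moreover have "norm (coord a b *\<^sub>R a) = norm (s *\<^sub>R b)" using s by simp
  ultimately have "coord a b = s" using p assms by simp
  then show False using s p assms(5) by simp
qed

section \<open>Projections onto finitely many atoms\<close>

definition atomic_proj :: "'a::banach_lattice set \<Rightarrow> 'a \<Rightarrow> 'a" where
  "atomic_proj A x = (\<Sum>a\<in>A. coord a x *\<^sub>R a)"

text \<open>Normalisation picks one atom from each ray, so that distinct members have vanishing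
  coordinates on each other.\<close>

definition unit_atoms :: "'a::banach_lattice set" where
  "unit_atoms = {a. atom a \<and> norm a = 1}"

lemma linear_atomic_proj: "A \<subseteq> unit_atoms \<Longrightarrow> linear (atomic_proj A)"
  unfolding atomic_proj_def
  by (intro linear_compose_sum ballI)
    (auto simp: unit_atoms_def linear_iff linear_add[OF linear_coord] linear_scale[OF linear_coord] scaleR_add_left)

lemma coord_atomic_proj_other:
  assumes "A \<subseteq> unit_atoms" "b \<in> unit_atoms" "b \<notin> A"
  shows "coord b (atomic_proj A x) = 0"
proof -
  have "coord b (atomic_proj A x) = (\<Sum>a\<in>A. coord a x * coord b a)"
    unfolding atomic_proj_def using assms
    by (auto simp: unit_atoms_def linear_sum[OF linear_coord] linear_scale[OF linear_coord])
  also have "\<dots> = 0"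
    using assms by (intro sum.neutral ballI) (metis (mono_tags, lifting) coord_other mem_Collect_eq
        mult_zero_right subsetD unit_atoms_def)
  finally show ?thesis .
qed

lemma atomic_proj_nonneg: "A \<subseteq> unit_atoms \<Longrightarrow> 0 \<le> x \<Longrightarrow> 0 \<le> atomic_proj A x"
  unfolding atomic_proj_def
  by (intro sum_nonneg scaleR_nonneg_nonneg) (auto simp: unit_atoms_def coord_nonneg atom_nonneg)

text \<open>By induction on the set of atoms: removing the components along \<open>A\<close> does
  not change the coordinate at a new atom \<open>b\<close>, so the component along \<open>b\<close>
  still fits below the remainder.\<close>

lemma atomic_proj_le:
  assumes "finite A" "A \<subseteq> unit_atoms" "0 \<le> x"
  shows "atomic_proj A x \<le> x"
  using assms
proof (induction A)
  case (insert b A)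
  then have b: "atom b" and P: "atomic_proj A x \<le> x" by (auto simp: unit_atoms_def)
  have "coord b (x - atomic_proj A x) = coord b x"
    using insert.prems insert.hyps coord_atomic_proj_other[of A b x] by (simp add: linear_diff[OF linear_coord[OF b]])
  then have "coord b x *\<^sub>R b \<le> x - atomic_proj A x"
    using coord_scaleR_le[OF b, of "x - atomic_proj A x"] P by simp
  then show ?case using insert.hyps by (simp add: atomic_proj_def algebra_simps)
qed (simp add: atomic_proj_def)

lemma atomic_proj_mono:
  assumes "finite B" "A \<subseteq> B" "B \<subseteq> unit_atoms" "0 \<le> x"
  shows "atomic_proj A x \<le> atomic_proj B x"
  unfolding atomic_proj_def using assms
  by (intro sum_mono2) (auto intro!: scaleR_nonneg_nonneg simp: unit_atoms_def coord_nonneg atom_nonneg)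

text \<open>The projection preserves each coordinate in \<open>A\<close>: after \<open>b\<close> is
  split off, the other atoms contribute nothing to the coordinate at \<open>b\<close>.\<close>

lemma atomic_proj_idem:
  assumes "finite A" "A \<subseteq> unit_atoms"
  shows "atomic_proj A (atomic_proj A x) = atomic_proj A x"
proof -
  have "coord b (atomic_proj A x) = coord b x" if b: "b \<in> A" for b
  proof -
    have "atomic_proj A x = atomic_proj (A - {b}) x + coord b x *\<^sub>R b"
      unfolding atomic_proj_def using assms b by (simp add: sum.remove add.commute)
    moreover have "atom b" "A - {b} \<subseteq> unit_atoms" "b \<in> unit_atoms"
      using assms b by (auto simp: unit_atoms_def)
    ultimately show ?thesis
      using coord_atomic_proj_other[of "A - {b}" b x]
      by (simp add: linear_add[OF linear_coord] linear_scale[OF linear_coord] coord_self)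
  qed
  then show ?thesis by (simp add: atomic_proj_def)
qed

lemma unit_atom_exists:
  fixes x :: "'a::atomic_banach_lattice"
  assumes "0 < x"
  shows "\<exists>a\<in>unit_atoms. \<exists>r>0. r *\<^sub>R a \<le> x"
proof -
  obtain a where a: "atom a" "a \<le> x" using atomic[OF assms] by blast
  define b where "b = inverse (norm a) *\<^sub>R a"
  have na: "norm a > 0" using atom_pos[OF a(1)] by simp
  have "atom b" unfolding atom_def
  proof (intro conjI allI impI)
    have "0 \<le> b" using na atom_nonneg[OF a(1)] by (simp add: b_def scaleR_nonneg_nonneg)
    moreover have "b \<noteq> 0" using na by (simp add: b_def)
    ultimately show "0 < b" by simp
    fix y assume "0 \<le> y \<and> y \<le> b"
    then obtain s where "y = s *\<^sub>R a"
      using atom_interval[OF a(1), of y "inverse (norm a)"] na by (auto simp: b_def)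
    then show "\<exists>r. y = r *\<^sub>R b"
      using na by (intro exI[of _ "s * norm a"]) (simp add: b_def)
  qed
  then have "b \<in> unit_atoms" using na by (simp add: unit_atoms_def b_def)
  moreover have "norm a *\<^sub>R b \<le> x" using na a by (simp add: b_def)
  ultimately show ?thesis using na by blast
qed

text \<open>The remainders \<open>x - atomic_proj A x\<close> decrease as \<open>A\<close> grows.
  Atomicity makes their infimum \<open>0\<close>, and order continuity turns this into small
  norm.\<close>

lemma atomic_proj_approx:
  fixes x :: "'a::{atomic_banach_lattice, order_continuous_banach_lattice}"
  assumes "0 \<le> x" "0 < e"
  shows "\<exists>A. finite A \<and> A \<subseteq> unit_atoms \<and> norm (x - atomic_proj A x) < e"
proof -
  define D where "D = {x - atomic_proj A x |A. finite A \<and> A \<subseteq> unit_atoms}"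
  have ne: "D \<noteq> {}" unfolding D_def by (auto intro!: exI[of _ "{}"])
  have dir: "\<exists>z\<in>D. z \<le> u \<and> z \<le> v" if uv: "u \<in> D" "v \<in> D" for u v
  proof -
    obtain A where A: "finite A" "A \<subseteq> unit_atoms" "u = x - atomic_proj A x"
      using uv(1) unfolding D_def mem_Collect_eq by metis
    obtain B where B: "finite B" "B \<subseteq> unit_atoms" "v = x - atomic_proj B x"
      using uv(2) unfolding D_def mem_Collect_eq by metis
    have "x - atomic_proj (A \<union> B) x \<in> D"
      using A(1,2) B(1,2) unfolding D_def mem_Collect_eq by (intro exI[of _ "A \<union> B"]) simp
    moreover have "atomic_proj A x \<le> atomic_proj (A \<union> B) x" "atomic_proj B x \<le> atomic_proj (A \<union> B) x"
      using A(1,2) B(1,2) assms(1) by (intro atomic_proj_mono; simp)+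
    ultimately show ?thesis
      using A(3) B(3) by (intro bexI[of _ "x - atomic_proj (A \<union> B) x"]) simp_all
  qed
  have "(norm \<longlongrightarrow> 0) (INF d\<in>D. principal {y\<in>D. y \<le> d})"
  proof (rule order_continuous[OF ne dir])
    show "0 \<le> y" if "y \<in> D" for y
      using that atomic_proj_le assms(1) by (auto simp: D_def)
    show "u \<le> 0" if u: "\<And>y. y \<in> D \<Longrightarrow> u \<le> y" for u
    proof (rule ccontr)
      assume "\<not> u \<le> 0"
      then have "0 < sup u 0" by (metis sup.cobounded1 sup_ge2 order.not_eq_order_implies_strict)
      then obtain a r where a: "a \<in> unit_atoms" "0 < r" "r *\<^sub>R a \<le> sup u 0"
        using unit_atom_exists by blast
      have at: "atom a" using a by (simp add: unit_atoms_def)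
      \<comment> \<open>The remainder of the singleton \<open>{a}\<close> suffices: if it still
        dominated \<open>r *\<^sub>R a\<close>, then \<open>x\<close> would dominate the multiple of
        \<open>a\<close> with factor \<open>r + coord a x\<close>, beyond the maximal one.\<close>
      have "sup u 0 \<le> x - atomic_proj {a} x"
        using u[of "x - atomic_proj {a} x"] a atomic_proj_le[of "{a}" x] assms(1)
        by (auto simp: D_def)
      then have "r *\<^sub>R a \<le> x - atomic_proj {a} x"
        using a(3) order_trans by blast
      then have "r *\<^sub>R a \<le> x - coord a x *\<^sub>R a" by (simp add: atomic_proj_def)
      then have "(r + coord a x) *\<^sub>R a \<le> x" by (simp add: algebra_simps)
      then show False using coord_upper[OF at assms(1)] a(2) by fastforce
    qed
  qed
  then have "eventually (\<lambda>y. norm y < e) (INF d\<in>D. principal {y\<in>D. y \<le> d})"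
    using assms(2) by (intro order_tendstoD(2)) auto
  \<comment> \<open>Directedness makes the tails a filter base, so the eventual bound already holds
    on a single tail; the tail of \<open>d\<close> contains \<open>d\<close> itself.\<close>
  then have "\<exists>d\<in>D. eventually (\<lambda>y. norm y < e) (principal {y\<in>D. y \<le> d})"
  proof (subst (asm) eventually_INF_base[OF ne])
    fix u v assume "u \<in> D" "v \<in> D"
    then obtain z where "z \<in> D" "z \<le> u" "z \<le> v" using dir by blast
    then show "\<exists>w\<in>D. principal {y \<in> D. y \<le> w} \<le> inf (principal {y \<in> D. y \<le> u}) (principal {y \<in> D. y \<le> v})"
      by (intro bexI[of _ z]) (auto intro: order_trans)
  qed
  then obtain d where "d \<in> D" "norm d < e" by (auto simp: eventually_principal)
  then show ?thesis by (auto simp: D_def)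
qed


section \<open>Positive operators on the complexification\<close>

lemma cplx_le_iff: "z \<le> w \<longleftrightarrow> re_part z \<le> re_part w \<and> im_part z = im_part w"
  by (rule less_eq_complexification_def)

lemma cplx_decomp: "z = complexify (re_part z) + \<i> *\<^sub>C complexify (im_part z)"
  for z :: "'a::real_vector complexification"
  by (simp add: cplx_eq_iff)

lemma norm_complexify: "norm (complexify x) = norm (x::'a::banach_lattice)"
  by (simp add: norm_complexification_def norm_abs_lattice)

lemma complexify_mono: "x \<le> y \<Longrightarrow> complexify x \<le> complexify y"
  by (simp add: cplx_le_iff)

lemma abs_cplx_nonneg: "0 \<le> \<bar>z\<bar>" for z :: "'a::banach_lattice complexification"
  by (simp add: cplx_le_iff abs_complexification_def)

lemma abs_cplx_of_nonneg: "0 \<le> z \<Longrightarrow> \<bar>z\<bar> = z" for z :: "'a::banach_lattice complexification"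
proof -
  assume "0 \<le> z"
  then have "z = complexify (re_part z)" "0 \<le> re_part z" by (simp_all add: cplx_le_iff cplx_eq_iff)
  then show ?thesis by (metis abs_complexification_def abs_of_nonneg modulus_complexify)
qed

lemma norm_abs_cplx: "norm \<bar>z\<bar> = norm z" for z :: "'a::banach_lattice complexification"
  by (simp add: abs_complexification_def norm_complexify norm_complexification_def[of z])

lemma norm_le_of_abs_le:
  fixes z :: "'a::banach_lattice complexification"
  assumes "\<bar>z\<bar> \<le> w"
  shows "norm z \<le> norm w"
proof -
  have "norm z \<le> norm (re_part w)"
    unfolding norm_complexification_def[of z] using assms
    by (intro norm_mono_pos) (auto simp: cplx_le_iff abs_complexification_def)
  then show ?thesis using norm_re_part_le[of w] by simp
qed

lemma clinear_simps:
  assumes "bounded_clinear T"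
  shows "T (x + y) = T x + T y" "T (x - y) = T x - T y" "T (- x) = - T x" "T 0 = 0"
    "T (r *\<^sub>R x) = r *\<^sub>R T x" "T (c *\<^sub>C x) = c *\<^sub>C T x" "T (sum f A) = (\<Sum>a\<in>A. T (f a))"
  using bounded_clinearD[OF assms] by (auto dest!: bounded_linear.linear
      simp: linear_add linear_diff linear_neg linear_0 linear_scale linear_sum)

lemma positive_operatorD:
  assumes "positive_operator T"
  shows "bounded_clinear T" "0 \<le> z \<Longrightarrow> 0 \<le> T z"
  using assms by (auto simp: positive_operator_def)

lemma positive_operator_mono:
  assumes "positive_operator T" "z \<le> w"
  shows "T z \<le> T w"
proof -
  have "0 \<le> T (w - z)" using assms(2) by (intro positive_operatorD(2)[OF assms(1)]) simp
  then show ?thesis by (simp add: clinear_simps[OF positive_operatorD(1)[OF assms(1)]])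
qed

text \<open>A real vector is a difference of positive ones, and \<open>0 \<le> w\<close> in the
  complexification includes \<open>im_part w = 0\<close>.\<close>

lemma positive_operator_real:
  assumes "positive_operator T"
  shows "im_part (T (complexify x)) = 0"
proof -
  have "complexify x = complexify (pprt x) - complexify (- nprt x)"
    using prts[of x] by (simp add: cplx_eq_iff)
  moreover have "0 \<le> T (complexify (pprt x))" "0 \<le> T (complexify (- nprt x))"
    by (rule positive_operatorD(2)[OF assms]; simp add: cplx_le_iff)+
  ultimately show ?thesis
    by (simp add: clinear_simps[OF positive_operatorD(1)[OF assms]] cplx_le_iff)
qed

lemma re_positive_operator:
  assumes "positive_operator T"
  shows "re_part (T z) = re_part (T (complexify (re_part z)))"
proof -
  have "T z = T (complexify (re_part z)) + \<i> *\<^sub>C T (complexify (im_part z))"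
    by (subst cplx_decomp) (simp add: clinear_simps[OF positive_operatorD(1)[OF assms]])
  then show ?thesis by (simp add: positive_operator_real[OF assms])
qed

text \<open>The modulus is a supremum over rotations. A rotation commutes with \<open>T\<close>, and
  the real part of the rotated vector is at most \<open>modulus z\<close>, so each term of the
  supremum is bounded by positivity.\<close>

lemma abs_positive_operator_le:
  assumes "positive_operator T"
  shows "\<bar>T z\<bar> \<le> T \<bar>z\<bar>"
proof -
  have "modulus (T z) \<le> re_part (T \<bar>z\<bar>)"
  proof (rule modulus_least)
    fix \<theta>
    define w where "w = cis (- \<theta>) *\<^sub>C z"
    have "cos \<theta> *\<^sub>R re_part (T z) + sin \<theta> *\<^sub>R im_part (T z) = re_part (cis (- \<theta>) *\<^sub>C T z)"
      by simp
    also have "\<dots> = re_part (T w)"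
      by (simp only: w_def clinear_simps[OF positive_operatorD(1)[OF assms]])
    also have "\<dots> = re_part (T (complexify (re_part w)))" by (rule re_positive_operator[OF assms])
    also have "\<dots> \<le> re_part (T \<bar>z\<bar>)"
    proof -
      have "re_part w \<le> modulus z" using modulus_upper[of \<theta> z] by (simp add: w_def)
      then have "T (complexify (re_part w)) \<le> T \<bar>z\<bar>"
        by (intro positive_operator_mono[OF assms]) (simp add: abs_complexification_def complexify_mono)
      then show ?thesis by (simp add: cplx_le_iff)
    qed
    finally show "cos \<theta> *\<^sub>R re_part (T z) + sin \<theta> *\<^sub>R im_part (T z) \<le> re_part (T \<bar>z\<bar>)" .
  qed
  then show ?thesis
    using positive_operator_real[OF assms] by (simp add: cplx_le_iff abs_complexification_def)
qed

section \<open>Domination between operators and their powers\<close>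

lemma dominates_positive:
  assumes "bounded_clinear T" "dominates T S"
  shows "positive_operator T"
  unfolding positive_operator_def using assms abs_cplx_nonneg abs_cplx_of_nonneg
  by (metis dominates_def order_trans)

lemma dominates_of_le:
  assumes "positive_operator S" "\<And>z. 0 \<le> z \<Longrightarrow> S z \<le> T z"
  shows "dominates T S"
  unfolding dominates_def using abs_positive_operator_le[OF assms(1)] assms(2) abs_cplx_nonneg order_trans
  by blast

lemma dominates_funpow:
  fixes S T :: "'a::banach_lattice complexification \<Rightarrow> 'a complexification"
  assumes "positive_operator T" "dominates T S"
  shows "dominates (T ^^ n) (S ^^ n)"
proof (induction n)
  case (Suc n)
  have "\<bar>S ((S ^^ n) z)\<bar> \<le> T ((T ^^ n) \<bar>z\<bar>)" for z
    using assms(2) Suc positive_operator_mono[OF assms(1)] unfolding dominates_def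
    by (meson order_trans)
  then show ?case by (simp add: dominates_def)
qed (simp add: dominates_def)

section \<open>Finite rank band projections\<close>

text \<open>Compactness serves to neglect \<open>P\<close> modulo compact operators,
  \<open>0 \<le> P z \<le> z\<close> makes the complement positive, and idempotence with
  finite-dimensional range detects finite-dimensional spaces. The span is the real one.\<close>

definition finite_band_proj :: "('a::banach_lattice complexification \<Rightarrow> 'a complexification) \<Rightarrow> bool" where
  "finite_band_proj P \<longleftrightarrow> compact_operator P \<and> (\<forall>z. 0 \<le> z \<longrightarrow> 0 \<le> P z \<and> P z \<le> z) \<and>
    (\<forall>z. P (P z) = P z) \<and> (\<exists>B. finite B \<and> range P \<subseteq> span B)"

lemma compact_operatorD: "compact_operator K \<Longrightarrow> bounded_clinear K"
  by (simp add: compact_operator_def)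

lemma bounded_clinear_diff:
  "bounded_clinear S \<Longrightarrow> bounded_clinear T \<Longrightarrow> bounded_clinear (\<lambda>x. S x - T x)"
  using bounded_clinear_add[OF _ bounded_clinear_minus, of S T] by simp

lemma bounded_clinear_ident: "bounded_clinear (\<lambda>x. x)"
  using bounded_clinear_id by (simp add: id_def)

lemma finite_band_proj_compl_positive:
  assumes "finite_band_proj P"
  shows "positive_operator (\<lambda>z. z - P z)"
  using assms bounded_clinear_diff[OF bounded_clinear_ident, of P] compact_operatorD[of P]
  unfolding finite_band_proj_def positive_operator_def by simp

text \<open>Positivity of the complement gives \<open>\<bar>z - P z\<bar> \<le> \<bar>z\<bar> - P
  \<bar>z\<bar> \<le> \<bar>z\<bar>\<close>, and the norm is monotone in the modulus.\<close>

lemma finite_band_proj_compl_contraction: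
  assumes "finite_band_proj P"
  shows "norm (z - P z) \<le> norm z"
proof -
  have "\<bar>z - P z\<bar> \<le> \<bar>z\<bar> - P \<bar>z\<bar>"
    by (rule abs_positive_operator_le[OF finite_band_proj_compl_positive[OF assms]])
  also have "\<dots> \<le> \<bar>z\<bar>"
    using assms abs_cplx_nonneg[of z] by (simp add: finite_band_proj_def)
  finally show ?thesis using norm_le_of_abs_le norm_abs_cplx by metis
qed

text \<open>Each summand ranges over a compact segment, and sums of compact sets are compact. This
  yields compactness of the projections, whose coefficients are bounded on the unit ball.\<close>

lemma compact_linear_combinations:
  fixes v :: "'i \<Rightarrow> 'a::real_normed_vector"
  assumes "finite I"
  shows "\<exists>K. compact K \<and> (\<forall>c. (\<forall>i\<in>I. \<bar>c i\<bar> \<le> M) \<longrightarrow> (\<Sum>i\<in>I. c i *\<^sub>R v i) \<in> K)"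
  using assms
proof (induction I)
  case empty
  then show ?case by (intro exI[of _ "{0}"]) auto
next
  case (insert j I)
  then obtain K where K: "compact K" "\<And>c. (\<forall>i\<in>I. \<bar>c i\<bar> \<le> M) \<Longrightarrow> (\<Sum>i\<in>I. c i *\<^sub>R v i) \<in> K"
    by blast
  define L where "L = (\<lambda>r. r *\<^sub>R v j) ` {-M..M}"
  have L: "compact L"
    unfolding L_def by (intro compact_continuous_image continuous_intros compact_Icc)
  have "(\<Sum>i\<in>insert j I. c i *\<^sub>R v i) \<in> {x + y |x y. x \<in> L \<and> y \<in> K}"
    if c: "\<forall>i\<in>insert j I. \<bar>c i\<bar> \<le> M" for c
  proof -
    have "c j *\<^sub>R v j \<in> L" using c by (auto simp: L_def abs_le_iff intro!: imageI)
    moreover have "(\<Sum>i\<in>I. c i *\<^sub>R v i) \<in> K" using c by (intro K(2)) auto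
    ultimately show ?thesis using insert.hyps by auto
  qed
  then show ?case using compact_sums[OF L K(1)] by blast
qed

text \<open>Positivity of the coordinate reduces to \<open>\<bar>x\<bar>\<close>, whose component
  along \<open>a\<close> lies below \<open>\<bar>x\<bar>\<close> and has norm equal to its
  coefficient, as \<open>norm a = 1\<close>.\<close>

lemma abs_coord_le:
  assumes "a \<in> unit_atoms"
  shows "\<bar>coord a x\<bar> \<le> norm x"
proof -
  have a: "atom a" "norm a = 1" using assms by (auto simp: unit_atoms_def)
  have "0 \<le> \<bar>x\<bar> - x" "0 \<le> \<bar>x\<bar> - (- x)"
    by (simp_all only: diff_ge_0_iff_ge abs_ge_self abs_ge_minus_self)
  then have "0 \<le> coord a (\<bar>x\<bar> - x)" "0 \<le> coord a (\<bar>x\<bar> - (- x))"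
    using coord_nonneg[OF a(1)] by blast+
  then have "\<bar>coord a x\<bar> \<le> coord a \<bar>x\<bar>"
    unfolding linear_diff[OF linear_coord[OF a(1)]] linear_neg[OF linear_coord[OF a(1)]] by linarith
  also have "\<dots> = norm (coord a \<bar>x\<bar> *\<^sub>R a)"
    using coord_nonneg[OF a(1), of "\<bar>x\<bar>"] a by simp
  also have "\<dots> \<le> norm x"
    using coord_scaleR_le[OF a(1), of "\<bar>x\<bar>"] coord_nonneg[OF a(1), of "\<bar>x\<bar>"] atom_nonneg[OF a(1)]
    by (subst norm_abs_lattice[symmetric, of x], intro norm_mono_pos) (auto simp: scaleR_nonneg_nonneg)
  finally show ?thesis .
qed

definition cplx_atomic_proj :: "'a::banach_lattice set \<Rightarrow> 'a complexification \<Rightarrow> 'a complexification" where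
  "cplx_atomic_proj A z = Cplx (atomic_proj A (re_part z)) (atomic_proj A (im_part z))"

lemma cplx_sum_sel:
  "re_part (sum f A) = (\<Sum>a\<in>A. re_part (f a))" "im_part (sum f A) = (\<Sum>a\<in>A. im_part (f a))"
  by (induction A rule: infinite_finite_induct) simp_all

lemma cplx_atomic_proj_sum:
  "cplx_atomic_proj A z =
    (\<Sum>a\<in>A. coord a (re_part z) *\<^sub>R complexify a) + (\<Sum>a\<in>A. coord a (im_part z) *\<^sub>R Cplx 0 a)"
  by (simp add: cplx_eq_iff cplx_atomic_proj_def cplx_sum_sel atomic_proj_def)

lemma finite_band_proj_cplx_atomic_proj:
  assumes A: "finite A" "A \<subseteq> unit_atoms"
  shows "finite_band_proj (cplx_atomic_proj A)"
proof -
  let ?P = "cplx_atomic_proj A"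
  have lin: "linear (atomic_proj A)" using A by (intro linear_atomic_proj)
  \<comment> \<open>Real and imaginary directions are kept apart as the families
    \<open>complexify a\<close> and \<open>Cplx 0 a\<close>, since only real coefficients are at
    hand.\<close>
  obtain K1 where K1: "compact K1"
    "\<And>c. (\<forall>a\<in>A. \<bar>c a\<bar> \<le> 1) \<Longrightarrow> (\<Sum>a\<in>A. c a *\<^sub>R complexify a) \<in> K1"
    using compact_linear_combinations[OF A(1), of 1 complexify] by blast
  obtain K2 where K2: "compact K2"
    "\<And>c. (\<forall>a\<in>A. \<bar>c a\<bar> \<le> 1) \<Longrightarrow> (\<Sum>a\<in>A. c a *\<^sub>R Cplx 0 a) \<in> K2"
    using compact_linear_combinations[OF A(1), of 1 "Cplx 0"] by blast
  define K where "K = {x + y |x y. x \<in> K1 \<and> y \<in> K2}"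
  have K: "compact K" unfolding K_def by (rule compact_sums[OF K1(1) K2(1)])
  have in_K: "?P z \<in> K" if "norm z \<le> 1" for z
  proof -
    have "\<forall>a\<in>A. \<bar>coord a (re_part z)\<bar> \<le> 1" "\<forall>a\<in>A. \<bar>coord a (im_part z)\<bar> \<le> 1"
      using that A abs_coord_le norm_re_part_le[of z] norm_im_part_le[of z]
      by (meson order_trans subsetD)+
    then show ?thesis
      using K1(2)[of "\<lambda>a. coord a (re_part z)"] K2(2)[of "\<lambda>a. coord a (im_part z)"]
      unfolding K_def cplx_atomic_proj_sum by blast
  qed
  have bound: "norm (atomic_proj A x) \<le> norm x * card A" for x
  proof -
    have "norm (atomic_proj A x) \<le> (\<Sum>a\<in>A. norm x)"
      unfolding atomic_proj_def using A abs_coord_le[of _ x]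
      by (intro sum_norm_le) (auto simp: unit_atoms_def subset_iff)
    then show ?thesis by (simp add: mult.commute)
  qed
  have "bounded_linear ?P"
  proof (rule bounded_linear_intro)
    show "?P (z + w) = ?P z + ?P w" "?P (r *\<^sub>R z) = r *\<^sub>R ?P z" for z w r
      by (simp_all add: cplx_atomic_proj_def cplx_eq_iff linear_add[OF lin] linear_scale[OF lin])
    fix z
    have "norm (?P z) \<le> norm (re_part z) * card A + norm (im_part z) * card A"
      using norm_cplx_le[of "?P z"] bound[of "re_part z"] bound[of "im_part z"]
      by (simp add: cplx_atomic_proj_def)
    also have "\<dots> \<le> norm z * card A + norm z * card A"
      by (intro add_mono mult_right_mono norm_re_part_le norm_im_part_le) auto
    finally show "norm (?P z) \<le> norm z * (2 * card A)" by simp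
  qed
  moreover have "?P (c *\<^sub>C z) = c *\<^sub>C ?P z" for c z
    by (simp add: cplx_atomic_proj_def cplx_eq_iff linear_add[OF lin] linear_diff[OF lin]
        linear_scale[OF lin])
  ultimately have "compact_operator ?P"
    unfolding compact_operator_iff using K in_K
    by (intro conjI bounded_clinearI exI[of _ K]) auto
  moreover have "0 \<le> ?P z \<and> ?P z \<le> z" if "0 \<le> z" for z
    using that atomic_proj_nonneg[OF A(2)] atomic_proj_le[OF A] linear_0[OF lin]
    by (auto simp: cplx_le_iff cplx_atomic_proj_def)
  moreover have "?P (?P z) = ?P z" for z
    by (simp add: cplx_atomic_proj_def atomic_proj_idem[OF A])
  moreover have "?P z \<in> span (complexify ` A \<union> Cplx 0 ` A)" for z
    unfolding cplx_atomic_proj_sum by (intro span_add span_sum span_scale) (simp_all add: span_base)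
  then have "range ?P \<subseteq> span (complexify ` A \<union> Cplx 0 ` A)" by blast
  moreover have "finite (complexify ` A \<union> Cplx 0 ` A)" using A(1) by simp
  ultimately show ?thesis unfolding finite_band_proj_def by (intro conjI allI impI exI[of _ "complexify ` A \<union> Cplx 0 ` A"]) simp_all
qed

text \<open>One positive vector, the sum \<open>x\<close> of the moduli, controls all of
  \<open>C\<close>: the complement of \<open>P\<close> is positive, so
  \<open>\<bar>c - P c\<bar>\<close> lies below \<open>x - P x\<close>.\<close>

lemma finite_band_proj_approx:
  fixes C :: "'a::{atomic_banach_lattice, order_continuous_banach_lattice} complexification set"
  assumes "finite C" "0 < e"
  shows "\<exists>P. finite_band_proj P \<and> (\<forall>c\<in>C. norm (c - P c) < e)"
proof -
  define x where "x = (\<Sum>c\<in>C. modulus c)"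
  have "0 \<le> x" by (simp add: x_def sum_nonneg)
  then obtain A where A: "finite A" "A \<subseteq> unit_atoms" "norm (x - atomic_proj A x) < e"
    using atomic_proj_approx[OF _ assms(2)] by blast
  define P where "P = cplx_atomic_proj A"
  have P: "finite_band_proj P" unfolding P_def by (rule finite_band_proj_cplx_atomic_proj[OF A(1,2)])
  have "norm (c - P c) < e" if "c \<in> C" for c
  proof -
    have "\<bar>c - P c\<bar> \<le> \<bar>c\<bar> - P \<bar>c\<bar>"
      by (rule abs_positive_operator_le[OF finite_band_proj_compl_positive[OF P]])
    also have "\<dots> \<le> complexify x - P (complexify x)"
    proof (rule positive_operator_mono[OF finite_band_proj_compl_positive[OF P]])
      have "modulus c \<le> x" unfolding x_def using that assms(1) by (simp add: sum.remove sum_nonneg)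
      then show "\<bar>c\<bar> \<le> complexify x" by (simp add: abs_complexification_def complexify_mono)
    qed
    finally have "norm (c - P c) \<le> norm (complexify x - P (complexify x))" by (rule norm_le_of_abs_le)
    also have "complexify x - P (complexify x) = complexify (x - atomic_proj A x)"
      by (simp add: P_def cplx_atomic_proj_def cplx_eq_iff linear_0[OF linear_atomic_proj[OF A(2)]])
    finally show ?thesis using A(3) by (simp add: norm_complexify)
  qed
  then show ?thesis using P by blast
qed


section \<open>The measure of non-compactness of an operator\<close>

lemma op_noncompactness_lessD:
  assumes "bounded_clinear T" "op_noncompactness T < r"
  obtains C where "finite C" "\<And>x. norm x \<le> 1 \<Longrightarrow> \<exists>c\<in>C. norm (T x - c) \<le> r"
proof -
  define D where "D = {\<delta>. 0 < \<delta> \<and> (\<exists>C. finite C \<and> T ` cball 0 1 \<subseteq> (\<Union>c\<in>C. cball c \<delta>))}"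
  obtain K where K: "0 < K" "\<And>x. norm (T x) \<le> norm x * K"
    using bounded_linear.pos_bounded[OF bounded_clinearD(1)[OF assms(1)]] by blast
  have "norm (T x) \<le> K" if x: "norm x \<le> 1" for x
    using K(2)[of x] mult_right_mono[OF that, of K] K(1) by linarith
  \<comment> \<open>A single ball around \<open>0\<close> shows that admissible radii exist, so the
    infimum is taken over a nonempty set.\<close>
  then have "K \<in> D" unfolding D_def using K(1) by (auto intro!: exI[of _ "{0}"])
  then have "\<exists>\<delta>\<in>D. \<delta> < r"
    using assms(2) cInf_lessD[of D r] unfolding op_noncompactness_def ball_noncompactness_def D_def
    by blast
  then obtain \<delta> C where C: "\<delta> < r" "finite C" "T ` cball 0 1 \<subseteq> (\<Union>c\<in>C. cball c \<delta>)"
    unfolding D_def by blast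
  have "\<exists>c\<in>C. norm (T x - c) \<le> r" if x: "norm x \<le> 1" for x
  proof -
    have "T x \<in> T ` cball 0 1" using that by simp
    then obtain c where "c \<in> C" "T x \<in> cball c \<delta>" using C(3) by blast
    then show ?thesis using C(1) by (intro bexI[of _ c]) (auto simp: dist_norm norm_minus_commute)
  qed
  then show thesis using C(2) that by blast
qed

text \<open>The slack \<open>e\<close> turns \<open>r\<close>, which may be zero, into the positive
  radius that the definition asks for.\<close>

lemma op_noncompactness_le:
  assumes "0 \<le> r"
    and "\<And>e. 0 < e \<Longrightarrow> \<exists>C. finite C \<and> (\<forall>x. norm x \<le> 1 \<longrightarrow> (\<exists>c\<in>C. norm (T x - c) \<le> r + e))"
  shows "op_noncompactness T \<le> r"
proof (rule field_le_epsilon)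
  fix e :: real assume "0 < e"
  then obtain C where C: "finite C" "\<And>x. norm x \<le> 1 \<Longrightarrow> \<exists>c\<in>C. norm (T x - c) \<le> r + e"
    using assms(2) by blast
  have "T ` cball 0 1 \<subseteq> (\<Union>c\<in>C. cball c (r + e))"
    using C(2) by (auto simp: dist_norm norm_minus_commute)
  then show "op_noncompactness T \<le> r + e"
    unfolding op_noncompactness_def ball_noncompactness_def using C(1) assms(1) \<open>0 < e\<close>
    by (intro cInf_lower) (auto intro!: bdd_belowI[of _ 0])
qed

lemma op_noncompactness_nonneg:
  assumes "bounded_clinear T"
  shows "0 \<le> op_noncompactness T"
proof (rule ccontr)
  assume "\<not> 0 \<le> op_noncompactness T"
  then obtain r where r: "op_noncompactness T < r" "r < 0" using dense[of "op_noncompactness T" 0] by auto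
  obtain C where C: "\<And>x. norm x \<le> 1 \<Longrightarrow> \<exists>c\<in>C. norm (T x - c) \<le> r"
    using op_noncompactness_lessD[OF assms r(1)] by blast
  obtain c where "norm (T 0 - c) \<le> r" using C[of 0] by auto
  then show False using r(2) norm_ge_zero[of "T 0 - c"] by linarith
qed

lemma compact_operator_net:
  assumes "compact_operator K" "0 < e"
  obtains C where "finite C" "\<And>x. norm x \<le> 1 \<Longrightarrow> \<exists>c\<in>C. norm (K x - c) \<le> e"
proof -
  have "seq_compact (closure (K ` cball 0 1))"
    using assms(1) by (intro compact_imp_seq_compact) (simp add: compact_operator_def)
  from seq_compact_imp_totally_bounded[OF this] assms(2)
  obtain C where C: "finite C" "closure (K ` cball 0 1) \<subseteq> (\<Union>c\<in>C. ball c e)" by meson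
  have "\<exists>c\<in>C. norm (K x - c) \<le> e" if x: "norm x \<le> 1" for x
  proof -
    have "K x \<in> K ` cball 0 1" using that by simp
    then have "K x \<in> closure (K ` cball 0 1)" by (rule subsetD[OF closure_subset])
    then obtain c where "c \<in> C" "K x \<in> ball c e" using C(2) by blast
    then show ?thesis by (intro bexI[of _ c]) (auto simp: dist_norm norm_minus_commute)
  qed
  then show thesis using C(1) that by blast
qed

text \<open>The centres of a finite \<open>e\<close>-net for the image of the ball under
  \<open>K\<close> serve for \<open>T\<close> with radius \<open>r + e\<close>.\<close>

lemma op_noncompactness_le_compact:
  assumes "compact_operator K" "0 \<le> r" "\<And>x. norm x \<le> 1 \<Longrightarrow> norm (T x - K x) \<le> r"
  shows "op_noncompactness T \<le> r"
proof (rule op_noncompactness_le[OF assms(2)])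
  fix e :: real assume "0 < e"
  then obtain C where C: "finite C" "\<And>x. norm x \<le> 1 \<Longrightarrow> \<exists>c\<in>C. norm (K x - c) \<le> e"
    using compact_operator_net[OF assms(1)] by blast
  have "\<exists>c\<in>C. norm (T x - c) \<le> r + e" if x: "norm x \<le> 1" for x
  proof -
    obtain c where "c \<in> C" "norm (K x - c) \<le> e" using C(2)[OF x] by blast
    then show ?thesis
      using assms(3)[OF that] norm_triangle_ineq[of "T x - K x" "K x - c"] by (intro bexI[of _ c]) auto
  qed
  then show "\<exists>C. finite C \<and> (\<forall>x. norm x \<le> 1 \<longrightarrow> (\<exists>c\<in>C. norm (T x - c) \<le> r + e))"
    using C(1) by blast
qed

section \<open>Compact operators, sums, products and powers\<close>

lemma compact_operator_zero: "compact_operator (\<lambda>x. 0)"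
  by (auto simp: compact_operator_iff bounded_clinear_zero intro!: exI[of _ "{0}"])

lemma op_noncompactness_compact:
  assumes "compact_operator K"
  shows "op_noncompactness K = 0"
  using op_noncompactness_le_compact[OF assms, of 0 K]
    op_noncompactness_nonneg[OF compact_operatorD[OF assms]] by simp

lemma op_noncompactness_le_norm:
  assumes "0 \<le> r" "\<And>x. norm (T x) \<le> r * norm x"
  shows "op_noncompactness T \<le> r"
  using assms(1)
proof (rule op_noncompactness_le_compact[OF compact_operator_zero])
  fix x :: 'a assume "norm x \<le> 1"
  then show "norm (T x - 0) \<le> r" using assms(2)[of x] mult_left_mono[of "norm x" 1 r] assms(1) by simp
qed

lemma op_noncompactness_add:
  assumes "bounded_clinear S" "bounded_clinear T"
  shows "op_noncompactness (\<lambda>x. S x + T x) \<le> op_noncompactness S + op_noncompactness T"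
proof (rule op_noncompactness_le)
  show "0 \<le> op_noncompactness S + op_noncompactness T"
    using assms op_noncompactness_nonneg by (intro add_nonneg_nonneg) auto
  fix e :: real assume e: "0 < e"
  obtain C where C: "finite C" "\<And>x. norm x \<le> 1 \<Longrightarrow> \<exists>c\<in>C. norm (S x - c) \<le> op_noncompactness S + e / 2"
    using op_noncompactness_lessD[OF assms(1), of "op_noncompactness S + e / 2"] e by auto
  obtain D where D: "finite D" "\<And>x. norm x \<le> 1 \<Longrightarrow> \<exists>d\<in>D. norm (T x - d) \<le> op_noncompactness T + e / 2"
    using op_noncompactness_lessD[OF assms(2), of "op_noncompactness T + e / 2"] e by auto
  have "\<exists>c\<in>(\<lambda>(c, d). c + d) ` (C \<times> D).
      norm (S x + T x - c) \<le> op_noncompactness S + op_noncompactness T + e" if x: "norm x \<le> 1" for x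
  proof -
    obtain c d where cd: "c \<in> C" "d \<in> D" "norm (S x - c) \<le> op_noncompactness S + e / 2"
      "norm (T x - d) \<le> op_noncompactness T + e / 2" using C(2)[OF x] D(2)[OF x] by blast
    have "norm (S x + T x - (c + d)) \<le> norm (S x - c) + norm (T x - d)"
      using norm_triangle_ineq[of "S x - c" "T x - d"] by (simp add: algebra_simps)
    then show ?thesis using cd by (intro bexI[of _ "c + d"]) force+
  qed
  then show "\<exists>C. finite C \<and> (\<forall>x. norm x \<le> 1 \<longrightarrow>
      (\<exists>c\<in>C. norm (S x + T x - c) \<le> op_noncompactness S + op_noncompactness T + e))"
    using C(1) D(1) by (intro exI[of _ "(\<lambda>(c, d). c + d) ` (C \<times> D)"]) auto
qed

text \<open>If \<open>T x\<close> is within \<open>t\<close> of a centre \<open>d\<close>, the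
  difference divided by \<open>t\<close> lies in the unit ball, and the cover for \<open>S\<close>
  applies to it. The new centres are \<open>S d + t *\<^sub>R c\<close>.\<close>

lemma op_noncompactness_comp_le:
  assumes "bounded_clinear S" "bounded_clinear T"
    and s: "op_noncompactness S < s" and t: "op_noncompactness T < t"
  shows "op_noncompactness (\<lambda>x. S (T x)) \<le> s * t"
proof (rule op_noncompactness_le)
  have st: "0 < s" "0 < t" using s t op_noncompactness_nonneg assms(1,2) le_less_trans by blast+
  then show "0 \<le> s * t" by simp
  obtain C where C: "finite C" "\<And>x. norm x \<le> 1 \<Longrightarrow> \<exists>c\<in>C. norm (S x - c) \<le> s"
    using op_noncompactness_lessD[OF assms(1) s] by auto
  obtain D where D: "finite D" "\<And>x. norm x \<le> 1 \<Longrightarrow> \<exists>d\<in>D. norm (T x - d) \<le> t"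
    using op_noncompactness_lessD[OF assms(2) t] by auto
  let ?C = "(\<lambda>(c, d). S d + t *\<^sub>R c) ` (C \<times> D)"
  have "\<exists>c\<in>?C. norm (S (T x) - c) \<le> s * t" if x: "norm x \<le> 1" for x
  proof -
    obtain d where d: "d \<in> D" "norm (T x - d) \<le> t" using D(2)[OF x] by blast
    define y where "y = inverse t *\<^sub>R (T x - d)"
    have "norm y = norm (T x - d) / t" using st by (simp add: y_def divide_inverse mult.commute)
    then have "norm y \<le> 1" using d(2) st by simp
    then obtain c where c: "c \<in> C" "norm (S y - c) \<le> s" using C(2) by blast
    have "T x = d + t *\<^sub>R y" using st by (simp add: y_def)
    then have "S (T x) - (S d + t *\<^sub>R c) = t *\<^sub>R (S y - c)"
      by (simp add: clinear_simps[OF assms(1)] algebra_simps)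
    then have "norm (S (T x) - (S d + t *\<^sub>R c)) \<le> s * t"
      using c(2) st by (simp add: mult.commute)
    then show ?thesis using c(1) d(1) by (intro bexI[of _ "S d + t *\<^sub>R c"]) force+
  qed
  then have "\<exists>c\<in>?C. norm (S (T x) - c) \<le> s * t + e" if "norm x \<le> 1" "0 < e" for x e
    using that by (meson add_increasing2 less_imp_le order_refl order_trans)
  moreover have "finite ?C" using C(1) D(1) by simp
  ultimately show "\<exists>C. finite C \<and> (\<forall>x. norm x \<le> 1 \<longrightarrow> (\<exists>c\<in>C. norm (S (T x) - c) \<le> s * t + e))"
    if "0 < e" for e :: real
    using that by blast
qed

text \<open>Strict upper bounds for the two factors, exceeding them by \<open>1 / (n + 1)\<close>,
  are let tend to the factors.\<close>

lemma op_noncompactness_comp: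
  assumes "bounded_clinear S" "bounded_clinear T"
  shows "op_noncompactness (\<lambda>x. S (T x)) \<le> op_noncompactness S * op_noncompactness T"
proof (rule LIMSEQ_le_const)
  let ?X = "\<lambda>n. (op_noncompactness S + inverse (real (Suc n))) * (op_noncompactness T + inverse (real (Suc n)))"
  have "?X \<longlonglongrightarrow> (op_noncompactness S + 0) * (op_noncompactness T + 0)"
    by (intro tendsto_intros LIMSEQ_inverse_real_of_nat)
  then show "?X \<longlonglongrightarrow> op_noncompactness S * op_noncompactness T" by simp
  show "\<exists>N. \<forall>n\<ge>N. op_noncompactness (\<lambda>x. S (T x)) \<le> ?X n"
    using op_noncompactness_comp_le[OF assms] by simp
qed

lemma bounded_clinear_scaleR: "bounded_clinear (\<lambda>x. r *\<^sub>R x)"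
  using bounded_clinear_scaleC[of "complex_of_real r"] by (simp add: scaleC_of_real)

lemma bounded_clinear_compose: "bounded_clinear S \<Longrightarrow> bounded_clinear T \<Longrightarrow> bounded_clinear (\<lambda>x. S (T x))"
  using bounded_clinear_comp[of S T] by (simp add: o_def)

lemma bounded_clinear_sum:
  "(\<And>i. i \<in> I \<Longrightarrow> bounded_clinear (f i)) \<Longrightarrow> bounded_clinear (\<lambda>x. \<Sum>i\<in>I. f i x)"
  by (induction I rule: infinite_finite_induct) (auto intro: bounded_clinear_add bounded_clinear_zero)

lemma bounded_clinear_funpow:
  fixes T :: "'a::complex_banach \<Rightarrow> 'a"
  shows "bounded_clinear T \<Longrightarrow> bounded_clinear (T ^^ n)"
  by (induction n) (auto intro: bounded_clinear_comp bounded_clinear_id)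

lemma op_noncompactness_scaleR:
  assumes "bounded_clinear T"
  shows "op_noncompactness (\<lambda>x. r *\<^sub>R T x) \<le> \<bar>r\<bar> * op_noncompactness T"
proof -
  have "op_noncompactness (\<lambda>x::'b. r *\<^sub>R x) \<le> \<bar>r\<bar>" by (rule op_noncompactness_le_norm) simp_all
  from mult_right_mono[OF this op_noncompactness_nonneg[OF assms]]
  show ?thesis
    using op_noncompactness_comp[OF bounded_clinear_scaleR[of r] assms] by linarith
qed

lemma op_noncompactness_funpow:
  fixes T :: "'a::complex_banach \<Rightarrow> 'a"
  assumes T: "bounded_clinear T"
  shows "op_noncompactness (T ^^ k) \<le> op_noncompactness T ^ k"
proof (induction k)
  case 0
  have "op_noncompactness (T ^^ 0) \<le> 1" by (rule op_noncompactness_le_norm) simp_all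
  then show ?case by (simp only: power_0)
next
  case (Suc k)
  have "op_noncompactness (T ^^ Suc k) \<le> op_noncompactness T * op_noncompactness (T ^^ k)"
    using op_noncompactness_comp[OF T bounded_clinear_funpow[OF T, of k]] by (simp add: o_def)
  also have "\<dots> \<le> op_noncompactness T * op_noncompactness T ^ k"
    by (rule mult_left_mono[OF Suc op_noncompactness_nonneg[OF T]])
  finally show ?case by (simp only: power_Suc)
qed

section \<open>Domination and non-compactness\<close>

text \<open>This is the upper estimate for the infimum of the norms of \<open>(I - P) T\<close>:
  \<open>P\<close> is chosen nearly the identity on a finite \<open>s\<close>-net of the image of
  the ball, with error \<open>r - s\<close>, and the contraction \<open>I - P\<close> does not
  enlarge the distance \<open>s\<close> to the net. Homogeneity extends the bound to all
  \<open>x\<close>.\<close>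

lemma finite_band_proj_approx_op:
  fixes T :: "'a::complex_banach \<Rightarrow> 'b::{atomic_banach_lattice, order_continuous_banach_lattice} complexification"
  assumes T: "bounded_clinear T" and r: "op_noncompactness T < r"
  shows "\<exists>P. finite_band_proj P \<and> (\<forall>x. norm (T x - P (T x)) \<le> r * norm x)"
proof -
  obtain s where s: "op_noncompactness T < s" "s < r" using r dense by blast
  obtain C where C: "finite C" "\<And>x. norm x \<le> 1 \<Longrightarrow> \<exists>c\<in>C. norm (T x - c) \<le> s"
    using op_noncompactness_lessD[OF T s(1)] by blast
  obtain P where P: "finite_band_proj P" "\<And>c. c \<in> C \<Longrightarrow> norm (c - P c) < r - s"
    using finite_band_proj_approx[OF C(1), of "r - s"] s by auto
  have lin: "bounded_clinear P" using P(1) by (simp add: finite_band_proj_def compact_operatorD)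
  have ball: "norm (T x - P (T x)) \<le> r" if x: "norm x \<le> 1" for x
  proof -
    obtain c where c: "c \<in> C" "norm (T x - c) \<le> s" using C(2)[OF x] by blast
    have "T x - P (T x) = ((T x - c) - P (T x - c)) + (c - P c)"
      by (simp add: clinear_simps[OF lin])
    then have "norm (T x - P (T x)) \<le> norm ((T x - c) - P (T x - c)) + norm (c - P c)"
      by (metis norm_triangle_ineq)
    then show ?thesis
      using finite_band_proj_compl_contraction[OF P(1), of "T x - c"] c P(2)[OF c(1)] by linarith
  qed
  have "norm (T x - P (T x)) \<le> r * norm x" for x
  proof (cases "x = 0")
    case False
    then have "norm (T (x /\<^sub>R norm x) - P (T (x /\<^sub>R norm x))) \<le> r" by (intro ball) simp
    also have "T (x /\<^sub>R norm x) - P (T (x /\<^sub>R norm x)) = (T x - P (T x)) /\<^sub>R norm x"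
      by (simp add: clinear_simps[OF lin] clinear_simps[OF T] algebra_simps)
    finally have "norm (T x - P (T x)) / norm x \<le> r" by (simp add: divide_inverse mult.commute)
    then show ?thesis using False by (simp add: divide_le_eq)
  qed (simp add: clinear_simps[OF lin] clinear_simps[OF T])
  then show ?thesis using P(1) by blast
qed

section \<open>Products with a compact factor, and monotonicity under domination\<close>

lemma compact_operator_comp_right:
  assumes "compact_operator K" "bounded_clinear S"
  shows "compact_operator (\<lambda>x. K (S x))"
proof -
  obtain C where C: "bounded_clinear K" "compact C" "K ` cball 0 1 \<subseteq> C"
    using assms(1) by (auto simp: compact_operator_iff)
  obtain b where b: "b > 0" "\<And>x. norm (S x) \<le> norm x * b"
    using bounded_linear.pos_bounded[OF bounded_clinearD(1)[OF assms(2)]] by blast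
  have "K (S x) \<in> (\<lambda>y. b *\<^sub>R y) ` C" if x: "norm x \<le> 1" for x
  proof -
    have "norm (S x) \<le> b" using b(2)[of x] mult_right_mono[OF that, of b] b(1) by linarith
    then have "S x /\<^sub>R b \<in> cball 0 1" using b(1) by (simp add: field_simps)
    then have "K (S x /\<^sub>R b) \<in> C" using C(3) by blast
    moreover have "K (S x) = b *\<^sub>R K (S x /\<^sub>R b)" using b(1) by (simp add: clinear_simps[OF C(1)])
    ultimately show ?thesis by blast
  qed
  then show ?thesis
    unfolding compact_operator_iff using compact_scaling[OF C(2), of b] bounded_clinear_compose[OF C(1) assms(2)]
    by (intro conjI exI[of _ "(\<lambda>y. b *\<^sub>R y) ` C"]) auto
qed

lemma compact_operator_comp_left:
  assumes "compact_operator K" "bounded_clinear S"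
  shows "compact_operator (\<lambda>x. S (K x))"
proof -
  obtain C where C: "bounded_clinear K" "compact C" "K ` cball 0 1 \<subseteq> C"
    using assms(1) by (auto simp: compact_operator_iff)
  have "compact (S ` C)"
    using C assms(2) by (intro compact_continuous_image) (auto simp: bounded_clinear_def linear_continuous_on)
  then show ?thesis
    unfolding compact_operator_iff using C bounded_clinear_compose[OF assms(2) C(1)]
    by (intro conjI exI[of _ "S ` C"]) auto
qed

lemma compact_operator_minus: "compact_operator K \<Longrightarrow> compact_operator (\<lambda>x. - K x)"
  using compact_operator_comp_left[of K "\<lambda>y. - y"] bounded_clinear_minus[OF bounded_clinear_ident] by blast

text \<open>Applying the positive operator \<open>I - P\<close> to
  \<open>\<bar>S x\<bar> \<le> T \<bar>x\<bar>\<close> bounds \<open>(I - P) S\<close> by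
  \<open>(I - P) T\<close>, while \<open>P S\<close> is compact.\<close>

lemma op_noncompactness_dominates:
  fixes S T :: "'a::banach_lattice complexification \<Rightarrow>
    'b::{atomic_banach_lattice, order_continuous_banach_lattice} complexification"
  assumes S: "bounded_clinear S" and T: "bounded_clinear T" and dom: "dominates T S"
  shows "op_noncompactness S \<le> op_noncompactness T"
proof (rule field_le_epsilon)
  fix e :: real assume e: "0 < e"
  let ?r = "op_noncompactness T + e"
  obtain P where P: "finite_band_proj P" "\<And>x. norm (T x - P (T x)) \<le> ?r * norm x"
    using finite_band_proj_approx_op[OF T, of ?r] e by auto
  have "norm (S x - P (S x)) \<le> ?r" if x: "norm x \<le> 1" for x
  proof -
    have r: "0 \<le> ?r" using op_noncompactness_nonneg[OF T] e by simp
    have "\<bar>S x - P (S x)\<bar> \<le> \<bar>S x\<bar> - P \<bar>S x\<bar>"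
      by (rule abs_positive_operator_le[OF finite_band_proj_compl_positive[OF P(1)]])
    also have "\<dots> \<le> T \<bar>x\<bar> - P (T \<bar>x\<bar>)"
      using dom by (intro positive_operator_mono[OF finite_band_proj_compl_positive[OF P(1)]])
        (simp add: dominates_def)
    finally have "norm (S x - P (S x)) \<le> norm (T \<bar>x\<bar> - P (T \<bar>x\<bar>))" by (rule norm_le_of_abs_le)
    also have "\<dots> \<le> ?r * norm x" using P(2)[of "\<bar>x\<bar>"] by (simp add: norm_abs_cplx)
    finally show ?thesis using mult_left_mono[OF that r] by simp
  qed
  moreover have "compact_operator (\<lambda>x. P (S x))"
    using compact_operator_comp_right[of P S] S P(1) by (simp add: finite_band_proj_def)
  moreover have "0 \<le> ?r" using op_noncompactness_nonneg[OF T] e by simp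
  ultimately show "op_noncompactness S \<le> ?r" using op_noncompactness_le_compact[of "\<lambda>x. P (S x)" ?r S] by blast
qed

text \<open>Some complement \<open>I - P\<close> has norm below \<open>1\<close>; being idempotent,
  it vanishes, so the space is the finite-dimensional range of \<open>P\<close>.\<close>

lemma finite_dim_of_op_noncompactness_id:
  assumes "op_noncompactness (\<lambda>x::'a::{atomic_banach_lattice, order_continuous_banach_lattice} complexification. x) < 1"
  shows "\<exists>B :: 'a complexification set. finite B \<and> span B = UNIV"
proof -
  obtain r where r: "op_noncompactness (\<lambda>x::'a complexification. x) < r" "r < 1"
    using assms dense by blast
  obtain P :: "'a complexification \<Rightarrow> 'a complexification"
    where P: "finite_band_proj P" "\<And>x. norm (x - P x) \<le> r * norm x"
    using finite_band_proj_approx_op[OF bounded_clinear_ident r(1)] by blast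
  have lin: "bounded_clinear P" using P(1) by (simp add: finite_band_proj_def compact_operatorD)
  have "x = P x" for x
  proof (rule ccontr)
    assume "x \<noteq> P x"
    then have "norm (x - P x) > 0" by simp
    moreover have "norm (x - P x) \<le> r * norm (x - P x)"
      using P(2)[of "x - P x"] P(1) by (simp add: clinear_simps[OF lin] finite_band_proj_def)
    ultimately show False using r(2) by simp
  qed
  then have "range P = UNIV" by (metis surjI)
  then show ?thesis using P(1) by (auto simp: finite_band_proj_def)
qed


section \<open>Invertibility modulo compact operators\<close>

lemma ring_hom_calkin_proj:
  "ring_hom_ring operator_algebra calkin_algebra (calkin_proj :: ('a::complex_banach \<Rightarrow> 'a) \<Rightarrow> _)"
  using ideal.rcos_ring_hom_ring[OF ideal_compact_operators]
  unfolding calkin_algebra_def calkin_proj_def[abs_def] .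

lemma calkin_proj_eqI:
  fixes S T :: "'a::complex_banach \<Rightarrow> 'a"
  assumes S: "bounded_clinear S" and T: "bounded_clinear T" and c: "compact_operator (\<lambda>x. S x - T x)"
  shows "calkin_proj S = calkin_proj T"
proof -
  interpret H: ring_hom_ring operator_algebra calkin_algebra "calkin_proj :: ('a \<Rightarrow> 'a) \<Rightarrow> _"
    by (rule ring_hom_calkin_proj)
  define K where "K = (\<lambda>x. S x - T x)"
  have K: "compact_operator K" using c by (simp add: K_def)
  have carr: "K \<in> carrier operator_algebra" "T \<in> carrier operator_algebra"
    using compact_operatorD[OF K] T by (simp_all add: operator_algebra_def)
  have "S = K \<oplus>\<^bsub>operator_algebra\<^esub> T" by (simp add: K_def operator_algebra_def)
  then have "calkin_proj S = calkin_proj K \<oplus>\<^bsub>calkin_algebra\<^esub> calkin_proj T"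
    using H.hom_add[of K T] carr by simp
  moreover have "calkin_proj K = \<zero>\<^bsub>calkin_algebra\<^esub>"
    using H.R.a_rcos_zero[OF ideal_compact_operators, of K] K
    by (simp add: calkin_proj_def calkin_algebra_def FactRing_def)
  moreover have "calkin_proj T \<in> carrier calkin_algebra"
    by (rule H.hom_closed[OF carr(2)])
  ultimately show ?thesis by simp
qed

lemma calkin_proj_eqD:
  fixes S T :: "'a::complex_banach \<Rightarrow> 'a"
  assumes S: "bounded_clinear S" and eq: "calkin_proj S = calkin_proj T"
  shows "compact_operator (\<lambda>x. S x - T x)"
proof -
  interpret I: ideal "{T. compact_operator T}" "operator_algebra :: ('a \<Rightarrow> 'a) ring"
    by (rule ideal_compact_operators)
  have "S \<in> calkin_proj S"
    unfolding calkin_proj_def using S by (intro I.a_rcos_self) (simp add: operator_algebra_def)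
  then have "S \<in> calkin_proj T" using eq by simp
  then obtain K where "compact_operator K" "S = (\<lambda>x. K x + T x)"
    by (auto simp: calkin_proj_def a_r_coset_def' operator_algebra_def)
  then show ?thesis by simp
qed

lemma calkin_proj_scalar_minus:
  fixes T :: "'a::complex_banach \<Rightarrow> 'a"
  assumes T: "bounded_clinear T"
  shows "calkin_proj (\<lambda>x. c *\<^sub>C x) \<ominus>\<^bsub>calkin_algebra\<^esub> calkin_proj T = calkin_proj (\<lambda>x. c *\<^sub>C x - T x)"
proof -
  interpret H: ring_hom_ring operator_algebra calkin_algebra "calkin_proj :: ('a \<Rightarrow> 'a) \<Rightarrow> _"
    by (rule ring_hom_calkin_proj)
  have carr: "T \<in> carrier operator_algebra" "(\<lambda>x. c *\<^sub>C x - T x) \<in> carrier operator_algebra"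
    using T bounded_clinear_diff[OF bounded_clinear_scaleC[of c] T] by (simp_all add: operator_algebra_def)
  have "(\<lambda>x. c *\<^sub>C x) = (\<lambda>x. c *\<^sub>C x - T x) \<oplus>\<^bsub>operator_algebra\<^esub> T"
    by (simp add: operator_algebra_def)
  from arg_cong[OF this, of calkin_proj]
  have "calkin_proj (\<lambda>x. c *\<^sub>C x) =
      calkin_proj (\<lambda>x. c *\<^sub>C x - T x) \<oplus>\<^bsub>calkin_algebra\<^esub> calkin_proj T"
    by (rule trans) (rule H.hom_add[OF carr(2,1)])
  then show ?thesis
    using H.hom_closed[OF carr(1)] H.hom_closed[OF carr(2)]
    by (simp add: H.S.minus_eq H.S.a_assoc H.S.r_neg)
qed

text \<open>\<open>L\<close> and \<open>R\<close> may differ as operators: in a monoid a left and a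
  right inverse of the same element coincide, so their classes agree.\<close>

lemma not_in_essential_spectrumI:
  fixes T :: "'a::complex_banach \<Rightarrow> 'a"
  assumes T: "bounded_clinear T" and L: "bounded_clinear L" and R: "bounded_clinear R"
    and KL: "compact_operator (\<lambda>x. L (c *\<^sub>C x - T x) - x)"
    and KR: "compact_operator (\<lambda>x. (c *\<^sub>C R x - T (R x)) - x)"
  shows "c \<notin> essential_spectrum T"
proof -
  interpret H: ring_hom_ring operator_algebra calkin_algebra "calkin_proj :: ('a \<Rightarrow> 'a) \<Rightarrow> _"
    by (rule ring_hom_calkin_proj)
  let ?A = "\<lambda>x. c *\<^sub>C x - T x"
  have A: "bounded_clinear ?A" by (rule bounded_clinear_diff[OF bounded_clinear_scaleC T])
  have carr: "?A \<in> carrier operator_algebra" "L \<in> carrier operator_algebra" "R \<in> carrier operator_algebra"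
    using A L R by (simp_all add: operator_algebra_def)
  have one: "\<one>\<^bsub>calkin_algebra\<^esub> = calkin_proj (id :: 'a \<Rightarrow> 'a)"
    using H.hom_one by (simp add: operator_algebra_def)
  have "calkin_proj (L \<circ> ?A) = calkin_proj id"
    using KL by (intro calkin_proj_eqI bounded_clinear_comp L A bounded_clinear_id) simp
  then have l: "calkin_proj L \<otimes>\<^bsub>calkin_algebra\<^esub> calkin_proj ?A = \<one>\<^bsub>calkin_algebra\<^esub>"
    using H.hom_mult[OF carr(2,1)] one by (simp add: operator_algebra_def)
  have "calkin_proj (?A \<circ> R) = calkin_proj id"
    using KR by (intro calkin_proj_eqI bounded_clinear_comp R A bounded_clinear_id) simp
  then have r: "calkin_proj ?A \<otimes>\<^bsub>calkin_algebra\<^esub> calkin_proj R = \<one>\<^bsub>calkin_algebra\<^esub>"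
    using H.hom_mult[OF carr(1,3)] one by (simp add: operator_algebra_def)
  have "calkin_proj L = calkin_proj R"
    by (rule H.S.inv_unique[OF l r]) (intro H.hom_closed carr)+
  then have "calkin_proj ?A \<in> Units calkin_algebra"
    unfolding Units_def using l r H.hom_closed[OF carr(1)] H.hom_closed[OF carr(3)] by auto
  then show ?thesis
    by (simp add: essential_spectrum_def calkin_proj_scalar_minus[OF T])
qed

text \<open>Every class in the quotient has an operator representing it, and equal classes differ by
  a compact operator; only the right half of the inverse is extracted.\<close>

lemma not_in_essential_spectrum_right_inverse:
  fixes T :: "'a::complex_banach \<Rightarrow> 'a"
  assumes T: "bounded_clinear T" and c: "c \<notin> essential_spectrum T"
  obtains R where "bounded_clinear R" "compact_operator (\<lambda>x. (c *\<^sub>C R x - T (R x)) - x)"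
proof -
  interpret H: ring_hom_ring operator_algebra calkin_algebra "calkin_proj :: ('a \<Rightarrow> 'a) \<Rightarrow> _"
    by (rule ring_hom_calkin_proj)
  let ?A = "\<lambda>x. c *\<^sub>C x - T x"
  have A: "bounded_clinear ?A" by (rule bounded_clinear_diff[OF bounded_clinear_scaleC T])
  have "calkin_proj ?A \<in> Units calkin_algebra"
    using c by (simp add: essential_spectrum_def calkin_proj_scalar_minus[OF T])
  then obtain Y where Y: "Y \<in> carrier calkin_algebra"
    "calkin_proj ?A \<otimes>\<^bsub>calkin_algebra\<^esub> Y = \<one>\<^bsub>calkin_algebra\<^esub>"
    unfolding Units_def by blast
  then obtain R where R: "R \<in> carrier operator_algebra" "Y = calkin_proj R"
    by (auto simp: calkin_algebra_def FactRing_def A_RCOSETS_def' calkin_proj_def)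
  have bR: "bounded_clinear R" using R(1) by (simp add: operator_algebra_def)
  have "calkin_proj (?A \<circ> R) = calkin_proj (id :: 'a \<Rightarrow> 'a)"
    using Y(2) R(2) H.hom_mult[OF _ R(1), of ?A] A H.hom_one by (simp add: operator_algebra_def)
  then have "compact_operator (\<lambda>x. (?A \<circ> R) x - id x)"
    by (intro calkin_proj_eqD bounded_clinear_comp A bR)
  then show thesis using that[OF bR] by simp
qed

section \<open>The asymptotic measure of non-compactness\<close>

text \<open>This is \<rho>, taken as an infimum so that each power gives a bound at once and no
  limit has to be shown to exist. The shift to \<open>Suc n\<close> avoids the root of order
  \<open>0\<close>.\<close>

definition asymp_noncompactness :: "('a::complex_banach \<Rightarrow> 'a) \<Rightarrow> real" where
  "asymp_noncompactness T = (INF n. root (Suc n) (op_noncompactness (T ^^ Suc n)))"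

lemma bdd_below_asymp_noncompactness:
  fixes T :: "'a::complex_banach \<Rightarrow> 'a"
  assumes "bounded_clinear T"
  shows "bdd_below (range (\<lambda>n. root (Suc n) (op_noncompactness (T ^^ Suc n))))"
  using op_noncompactness_nonneg[OF bounded_clinear_funpow[OF assms]]
  by (intro bdd_belowI[of _ 0]) (auto simp del: funpow.simps)

lemma asymp_noncompactness_nonneg:
  fixes T :: "'a::complex_banach \<Rightarrow> 'a"
  assumes "bounded_clinear T"
  shows "0 \<le> asymp_noncompactness T"
  unfolding asymp_noncompactness_def using op_noncompactness_nonneg[OF bounded_clinear_funpow[OF assms]]
  by (intro cINF_greatest) (auto simp del: funpow.simps)

lemma asymp_noncompactness_power_le:
  fixes T :: "'a::complex_banach \<Rightarrow> 'a"
  assumes "bounded_clinear T"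
  shows "asymp_noncompactness T ^ Suc n \<le> op_noncompactness (T ^^ Suc n)"
proof -
  have q: "0 \<le> op_noncompactness (T ^^ Suc n)"
    by (rule op_noncompactness_nonneg[OF bounded_clinear_funpow[OF assms]])
  have "asymp_noncompactness T \<le> root (Suc n) (op_noncompactness (T ^^ Suc n))"
    unfolding asymp_noncompactness_def
    by (rule cINF_lower[OF bdd_below_asymp_noncompactness[OF assms] UNIV_I])
  then have "asymp_noncompactness T ^ Suc n \<le> root (Suc n) (op_noncompactness (T ^^ Suc n)) ^ Suc n"
    by (rule power_mono[OF _ asymp_noncompactness_nonneg[OF assms]])
  also have "\<dots> = op_noncompactness (T ^^ Suc n)"
    by (rule real_root_pow_pos2[OF zero_less_Suc q])
  finally show ?thesis .
qed

lemma asymp_noncompactness_lessD: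
  fixes T :: "'a::complex_banach \<Rightarrow> 'a"
  assumes "bounded_clinear T" "asymp_noncompactness T < r"
  obtains n where "op_noncompactness (T ^^ Suc n) < r ^ Suc n"
proof -
  obtain n where n: "root (Suc n) (op_noncompactness (T ^^ Suc n)) < r"
    using assms(2) unfolding asymp_noncompactness_def
    by (subst (asm) cINF_less_iff[OF UNIV_not_empty bdd_below_asymp_noncompactness[OF assms(1)]]) blast
  have q: "0 \<le> op_noncompactness (T ^^ Suc n)"
    by (rule op_noncompactness_nonneg[OF bounded_clinear_funpow[OF assms(1)]])
  have "root (Suc n) (op_noncompactness (T ^^ Suc n)) ^ Suc n < r ^ Suc n"
    using q by (intro power_strict_mono[OF n]) (simp_all del: funpow.simps)
  then show thesis using that[of n] real_root_pow_pos2[OF zero_less_Suc q] by simp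
qed

lemma asymp_noncompactness_mono:
  fixes S :: "'a::complex_banach \<Rightarrow> 'a" and T :: "'b::complex_banach \<Rightarrow> 'b"
  assumes "bounded_clinear S" "\<And>n. op_noncompactness (S ^^ n) \<le> op_noncompactness (T ^^ n)"
  shows "asymp_noncompactness S \<le> asymp_noncompactness T"
  unfolding asymp_noncompactness_def
proof (rule cINF_mono[OF UNIV_not_empty bdd_below_asymp_noncompactness[OF assms(1)]])
  fix n
  show "\<exists>m\<in>UNIV. root (Suc m) (op_noncompactness (S ^^ Suc m)) \<le> root (Suc n) (op_noncompactness (T ^^ Suc n))"
    using assms(2)[of "Suc n"] by (intro bexI[of _ n]) (simp_all del: funpow.simps)
qed

section \<open>Upper bound for the essential spectrum\<close>

lemma scalar_minus_inverse:
  fixes B :: "'a::complex_banach \<Rightarrow> 'a"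
  assumes B: "bounded_clinear B" and k: "0 \<le> k" "\<And>x. norm (B x) \<le> k * norm x" "k < cmod c"
  obtains U where "bounded_clinear U" "\<And>x. U (c *\<^sub>C x - B x) = x" "\<And>x. c *\<^sub>C U x - B (U x) = x"
proof -
  note lin = clinear_simps[OF B]
  have c: "cmod c > 0" "c \<noteq> 0" using k by auto
  have one: "(1::complex) *\<^sub>C x = x" for x :: 'a using scaleC_of_real[of 1 x] by simp
  have ex: "\<exists>!x. c *\<^sub>C x - B x = y" for y
  proof -
    \<comment> \<open>Solutions of \<open>c *\<^sub>C x - B x = y\<close> are the fixed points of
      \<open>f\<close>, which contracts by the factor \<open>k / cmod c < 1\<close>, so Banach's
      theorem replaces the Neumann series.\<close>
    define f where "f x = inverse c *\<^sub>C (y + B x)" for x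
    have "\<exists>!x. f x = x"
    proof (rule banach_fix_type)
      show "0 \<le> k / cmod c" "k / cmod c < 1" using k c by simp_all
      show "\<forall>x z. dist (f x) (f z) \<le> k / cmod c * dist x z"
      proof (intro allI)
        fix x z
        have "f x - f z = inverse c *\<^sub>C ((y + B x) + - (y + B z))"
          unfolding f_def scaleC_add_right[of "inverse c" "y + B x"] scaleC_minus_right by simp
        also have "\<dots> = inverse c *\<^sub>C B (x - z)" by (simp add: lin(2))
        finally have "norm (f x - f z) = norm (B (x - z)) / cmod c"
          by (simp add: norm_scaleC norm_inverse divide_inverse mult.commute)
        also have "\<dots> \<le> k * norm (x - z) / cmod c" using k(2) c by (intro divide_right_mono) auto
        finally show "dist (f x) (f z) \<le> k / cmod c * dist x z" by (simp add: dist_norm)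
      qed
    qed
    moreover have "f x = x \<longleftrightarrow> c *\<^sub>C x - B x = y" for x
    proof
      assume "f x = x"
      then have "c *\<^sub>C inverse c *\<^sub>C (y + B x) = c *\<^sub>C x" by (simp add: f_def)
      then show "c *\<^sub>C x - B x = y" using c by (simp add: scaleC_scaleC one algebra_simps)
    next
      assume "c *\<^sub>C x - B x = y"
      then have "y + B x = c *\<^sub>C x" by (simp add: algebra_simps)
      then show "f x = x" using c by (simp add: f_def scaleC_scaleC one)
    qed
    ultimately show ?thesis by simp
  qed
  define U where "U y = (THE x. c *\<^sub>C x - B x = y)" for y
  have R: "c *\<^sub>C U y - B (U y) = y" for y unfolding U_def by (rule theI'[OF ex])
  have L: "U (c *\<^sub>C x - B x) = x" for x unfolding U_def using ex[of "c *\<^sub>C x - B x"] by (intro the_equality) blast+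
  have Leq: "U y = x" if "c *\<^sub>C x - B x = y" for x y using L that by blast
  have scaleC_diff: "d *\<^sub>C (x - y) = d *\<^sub>C x - d *\<^sub>C y" for d and x y :: 'a
    using scaleC_add_right[of d x "- y"] by (simp add: scaleC_minus_right)
  have comm: "a *\<^sub>C b *\<^sub>C x = b *\<^sub>C a *\<^sub>C x" for a b and x :: 'a by (simp add: scaleC_scaleC mult.commute)
  have add: "U (x + y) = U x + U y" for x y
    using R[of x] R[of y] by (intro Leq) (simp add: lin scaleC_add_right algebra_simps)
  have scaleC: "U (d *\<^sub>C x) = d *\<^sub>C U x" for d x
    using R[of x] by (intro Leq) (simp add: lin comm[of c d] flip: scaleC_diff)
  have scaleR: "U (r *\<^sub>R x) = r *\<^sub>R U x" for r x
    using scaleC[of "complex_of_real r" x] by (simp add: scaleC_of_real)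
  \<comment> \<open>From \<open>cmod c * norm (U y) \<le> norm y + k * norm (U y)\<close> the last
    term is absorbed on the left.\<close>
  have bound: "norm (U y) \<le> norm y * inverse (cmod c - k)" for y
  proof -
    have "cmod c * norm (U y) = norm (y + B (U y))" using R[of y] by (metis diff_add_cancel norm_scaleC)
    also have "\<dots> \<le> norm y + k * norm (U y)" using norm_triangle_ineq[of y "B (U y)"] k(2)[of "U y"] by linarith
    finally have "norm (U y) * (cmod c - k) \<le> norm y" by (simp add: algebra_simps)
    then show ?thesis using k(3) by (simp add: divide_inverse[symmetric] pos_le_divide_eq)
  qed
  have "bounded_clinear U"
    by (intro bounded_clinearI bounded_linear_intro[where K = "inverse (cmod c - k)"])
      (rule add scaleR bound scaleC)+
  then show thesis using that L R by blast
qed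

text \<open>\<open>G\<close> is the cofactor in the factorisation of \<open>c ^ n - S ^ n\<close> by
  \<open>c - S\<close>. It starts from \<open>0\<close> and is built by the recursion that sends
  \<open>G\<close> to \<open>c G + S ^ n\<close>.\<close>

lemma geometric_factor:
  fixes S :: "'a::complex_banach \<Rightarrow> 'a"
  assumes S: "bounded_clinear S"
  shows "\<exists>G. bounded_clinear G \<and> (\<forall>x. c *\<^sub>C G x - S (G x) = c ^ n *\<^sub>C x - (S ^^ n) x) \<and>
    (\<forall>x. G (c *\<^sub>C x - S x) = c ^ n *\<^sub>C x - (S ^^ n) x)"
proof (induction n)
  case 0
  have "(1::complex) *\<^sub>C x = x" for x :: 'a using scaleC_of_real[of 1 x] by simp
  then show ?case
    by (intro exI[of _ "\<lambda>x. 0"]) (simp add: bounded_clinear_zero scaleC_zero_right clinear_simps[OF S])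
next
  case (Suc n)
  then obtain G where G: "bounded_clinear G" "\<And>x. c *\<^sub>C G x - S (G x) = c ^ n *\<^sub>C x - (S ^^ n) x"
    "\<And>x. G (c *\<^sub>C x - S x) = c ^ n *\<^sub>C x - (S ^^ n) x" by blast
  have scaleC_diff: "d *\<^sub>C (x - y) = d *\<^sub>C x - d *\<^sub>C y" for d and x y :: 'a
    using scaleC_add_right[of d x "- y"] by (simp add: scaleC_minus_right)
  have Sn: "bounded_clinear (S ^^ n)" by (rule bounded_clinear_funpow[OF S])
  have comm: "(S ^^ n) (S x) = S ((S ^^ n) x)" for x by (simp add: funpow_swap1)
  let ?G = "\<lambda>x. c *\<^sub>C G x + (S ^^ n) x"
  have "bounded_clinear ?G"
    by (intro bounded_clinear_add bounded_clinear_compose[OF bounded_clinear_scaleC] G(1) Sn)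
  moreover have "c *\<^sub>C ?G x - S (?G x) = c ^ Suc n *\<^sub>C x - (S ^^ Suc n) x" for x
  proof -
    have "c *\<^sub>C ?G x - S (?G x) = c *\<^sub>C (c *\<^sub>C G x - S (G x)) + c *\<^sub>C (S ^^ n) x - S ((S ^^ n) x)"
      by (simp add: clinear_simps[OF S] scaleC_add_right scaleC_diff)
    then show ?thesis by (simp add: G(2) scaleC_diff scaleC_scaleC)
  qed
  moreover have "?G (c *\<^sub>C x - S x) = c ^ Suc n *\<^sub>C x - (S ^^ Suc n) x" for x
    by (simp add: G(3) clinear_simps[OF Sn] comm scaleC_diff scaleC_scaleC)
  ultimately show ?case by blast
qed

text \<open>Otherwise \<open>S ^^ m\<close> is, up to the compact operator \<open>P S ^^ m\<close>,
  an operator \<open>B\<close> of norm below \<open>cmod c ^ m\<close>. With \<open>U\<close> the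
  inverse of \<open>c ^ m - B\<close> and \<open>G\<close> the cofactor, \<open>U G\<close> and
  \<open>G U\<close> are left and right inverses of \<open>c - S\<close> modulo compact
  operators.\<close>

lemma essential_spectrum_bound:
  fixes S :: "'a::{atomic_banach_lattice, order_continuous_banach_lattice} complexification \<Rightarrow> 'a complexification"
  assumes S: "bounded_clinear S" and c: "c \<in> essential_spectrum S"
  shows "cmod c \<le> asymp_noncompactness S"
proof (rule ccontr)
  assume "\<not> cmod c \<le> asymp_noncompactness S"
  then obtain n where n: "op_noncompactness (S ^^ Suc n) < cmod c ^ Suc n"
    using asymp_noncompactness_lessD[OF S, of "cmod c"] by auto
  define m where "m = Suc n"
  have Sm: "bounded_clinear (S ^^ m)" by (rule bounded_clinear_funpow[OF S])
  obtain k where k: "op_noncompactness (S ^^ m) < k" "k < cmod (c ^ m)"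
    using n dense unfolding m_def norm_power by blast
  obtain P where P: "finite_band_proj P" "\<And>x. norm ((S ^^ m) x - P ((S ^^ m) x)) \<le> k * norm x"
    using finite_band_proj_approx_op[OF Sm k(1)] by blast
  have cP: "compact_operator P" using P(1) by (simp add: finite_band_proj_def)
  define B where "B x = (S ^^ m) x - P ((S ^^ m) x)" for x
  have B: "bounded_clinear B"
    unfolding B_def[abs_def] by (intro bounded_clinear_diff Sm bounded_clinear_compose[OF compact_operatorD[OF cP] Sm])
  have k0: "0 \<le> k" using k(1) op_noncompactness_nonneg[OF Sm] by simp
  obtain U where U: "bounded_clinear U" "\<And>x. U (c ^ m *\<^sub>C x - B x) = x" "\<And>x. c ^ m *\<^sub>C U x - B (U x) = x"
    using scalar_minus_inverse[OF B k0 _ k(2)] P(2) unfolding B_def by blast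
  obtain G where G: "bounded_clinear G" "\<And>x. c *\<^sub>C G x - S (G x) = c ^ m *\<^sub>C x - (S ^^ m) x"
    "\<And>x. G (c *\<^sub>C x - S x) = c ^ m *\<^sub>C x - (S ^^ m) x"
    using geometric_factor[OF S, of c m] by blast
  have dec: "c ^ m *\<^sub>C x - (S ^^ m) x = (c ^ m *\<^sub>C x - B x) - P ((S ^^ m) x)" for x
    by (simp add: B_def)
  have "U (G (c *\<^sub>C x - S x)) - x = - U (P ((S ^^ m) x))" for x
    using clinear_simps(2)[OF U(1), of "c ^ m *\<^sub>C x - B x" "P ((S ^^ m) x)"] U(2)[of x]
    unfolding G(3) dec by simp
  moreover have "compact_operator (\<lambda>x. - U (P ((S ^^ m) x)))"
    by (intro compact_operator_minus compact_operator_comp_left[OF _ U(1)] compact_operator_comp_right[OF cP Sm])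
  ultimately have L: "compact_operator (\<lambda>x. U (G (c *\<^sub>C x - S x)) - x)" by simp
  have "(c *\<^sub>C G (U x) - S (G (U x))) - x = - P ((S ^^ m) (U x))" for x
    unfolding G(2) dec U(3) by simp
  moreover have "compact_operator (\<lambda>x. - P ((S ^^ m) (U x)))"
    by (intro compact_operator_minus compact_operator_comp_right[OF cP bounded_clinear_compose[OF Sm U(1)]])
  ultimately have R: "compact_operator (\<lambda>x. (c *\<^sub>C G (U x) - S (G (U x))) - x)" by simp
  show False
    using not_in_essential_spectrumI[OF S bounded_clinear_compose[OF U(1) G(1)]
        bounded_clinear_compose[OF G(1) U(1)] L R] c by contradiction
qed


section \<open>The essential spectral radius of a positive operator\<close>

lemma positive_operator_funpow:
  fixes T :: "'a::banach_lattice complexification \<Rightarrow> 'a complexification"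
  assumes "positive_operator T"
  shows "positive_operator (T ^^ n)"
proof -
  have "0 \<le> (T ^^ n) z" if "0 \<le> z" for z
    using that by (induction n) (auto intro: positive_operatorD(2)[OF assms])
  then show ?thesis
    using bounded_clinear_funpow[OF positive_operatorD(1)[OF assms]] by (simp add: positive_operator_def)
qed

section \<open>Partial sums of the Neumann series for the resolvent at \<open>l\<close>\<close>

definition partial_resolvent ::
    "('a::complex_banach \<Rightarrow> 'a) \<Rightarrow> real \<Rightarrow> nat \<Rightarrow> 'a \<Rightarrow> 'a" where
  "partial_resolvent T l n x = (\<Sum>k<n. inverse l ^ Suc k *\<^sub>R (T ^^ k) x)"

lemma bounded_clinear_partial_resolvent:
  assumes "bounded_clinear T"
  shows "bounded_clinear (partial_resolvent T l n)"
  unfolding partial_resolvent_def[abs_def]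
  by (intro bounded_clinear_sum bounded_clinear_compose[OF bounded_clinear_scaleR] bounded_clinear_funpow assms)

lemma partial_resolvent_mono:
  assumes "positive_operator T" "0 < l" "n \<le> m" "0 \<le> z"
  shows "partial_resolvent T l n z \<le> partial_resolvent T l m z"
  unfolding partial_resolvent_def using assms
  by (intro sum_mono2) (auto intro!: scaleR_nonneg_nonneg positive_operatorD(2)[OF positive_operator_funpow])

lemma positive_partial_resolvent:
  assumes "positive_operator T" "0 < l"
  shows "positive_operator (partial_resolvent T l n)"
proof -
  have "0 \<le> partial_resolvent T l n z" if "0 \<le> z" for z
    using partial_resolvent_mono[OF assms le0 that, of n] by (simp add: partial_resolvent_def)
  then show ?thesis
    using bounded_clinear_partial_resolvent[OF positive_operatorD(1)[OF assms(1)]]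
    by (simp add: positive_operator_def)
qed

text \<open>The sum telescopes; what remains is the first term and the one of order
  \<open>n\<close>.\<close>

lemma partial_resolvent_apply:
  assumes "bounded_clinear T" "0 < l"
  shows "partial_resolvent T l n (l *\<^sub>R x - T x) = x - inverse l ^ n *\<^sub>R (T ^^ n) x"
proof (induction n)
  case (Suc n)
  have "(T ^^ n) (l *\<^sub>R x - T x) = l *\<^sub>R (T ^^ n) x - (T ^^ Suc n) x"
    by (simp add: clinear_simps[OF bounded_clinear_funpow[OF assms(1)]] funpow_swap1)
  then have "inverse l ^ Suc n *\<^sub>R (T ^^ n) (l *\<^sub>R x - T x) =
      (inverse l ^ Suc n * l) *\<^sub>R (T ^^ n) x - inverse l ^ Suc n *\<^sub>R (T ^^ Suc n) x"
    by (simp only: scaleR_diff_right scaleR_scaleR)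
  moreover have "inverse l ^ Suc n * l = inverse l ^ n" using assms(2) by simp
  moreover have "partial_resolvent T l (Suc n) (l *\<^sub>R x - T x) =
      partial_resolvent T l n (l *\<^sub>R x - T x) + inverse l ^ Suc n *\<^sub>R (T ^^ n) (l *\<^sub>R x - T x)"
    by (simp only: partial_resolvent_def sum.lessThan_Suc)
  ultimately show ?case by (simp only: Suc) simp
qed (simp add: partial_resolvent_def)

text \<open>One good exponent \<open>Suc j\<close> propagates to its multiples by
  submultiplicativity, and the multiple \<open>Suc j * N\<close> is at least
  \<open>N\<close>.\<close>

lemma op_noncompactness_funpow_frequently_le:
  fixes T :: "'a::complex_banach \<Rightarrow> 'a"
  assumes T: "bounded_clinear T" and l: "asymp_noncompactness T < l"
  shows "\<exists>n\<ge>N. op_noncompactness (T ^^ n) \<le> l ^ n"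
proof -
  obtain j where j: "op_noncompactness (T ^^ Suc j) < l ^ Suc j"
    using asymp_noncompactness_lessD[OF T l] by blast
  have bj: "bounded_clinear (T ^^ Suc j)" by (rule bounded_clinear_funpow[OF T])
  have "op_noncompactness (T ^^ (Suc j * N)) = op_noncompactness ((T ^^ Suc j) ^^ N)"
    by (simp only: funpow_mult mult.commute)
  also have "\<dots> \<le> op_noncompactness (T ^^ Suc j) ^ N" by (rule op_noncompactness_funpow[OF bj])
  also have "\<dots> \<le> (l ^ Suc j) ^ N"
    using j by (intro power_mono op_noncompactness_nonneg[OF bj]) simp
  also have "\<dots> = l ^ (Suc j * N)" by (simp only: power_mult)
  finally show ?thesis by (intro exI[of _ "Suc j * N"]) simp
qed

text \<open>Applying the partial sum \<open>X\<close> to the identity written through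
  \<open>Q\<close> gives \<open>X = Q + Y1 + Y2 + Y3\<close>, where \<open>Y1\<close> contributes at
  most \<chi>(Q), \<open>Y2\<close> at most half of \<chi>(X), and \<open>Y3\<close> is compact.
  Absorbing that half leaves \<chi>(X) \<le> 4 \<chi>(Q), with a constant independent of the length
  of the sum.\<close>

lemma op_noncompactness_partial_resolvent_le:
  fixes T :: "'a::{atomic_banach_lattice, order_continuous_banach_lattice} complexification \<Rightarrow> 'a complexification"
  assumes T: "positive_operator T" and Q: "bounded_clinear Q"
    and K: "compact_operator (\<lambda>x. (r *\<^sub>R Q x - T (Q x)) - x)"
    and r: "r = asymp_noncompactness T" "r < l" and small: "(l - r) * op_noncompactness Q \<le> 1 / 2"
  shows "op_noncompactness (partial_resolvent T l N) \<le> 4 * op_noncompactness Q"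
proof -
  have bT: "bounded_clinear T" by (rule positive_operatorD(1)[OF T])
  have l: "0 < l" using r asymp_noncompactness_nonneg[OF bT] by simp
  \<comment> \<open>The length is enlarged to an \<open>n\<close> at which the telescoping remainder
    is under control; positivity leads back to \<open>N\<close> at the end.\<close>
  obtain n where n: "N \<le> n" "op_noncompactness (T ^^ n) \<le> l ^ n"
    using op_noncompactness_funpow_frequently_le[OF bT] r by blast
  define X where "X = partial_resolvent T l n"
  define K where "K = (\<lambda>x. (r *\<^sub>R Q x - T (Q x)) - x)"
  have bX: "bounded_clinear X" unfolding X_def by (rule bounded_clinear_partial_resolvent[OF bT])
  have bTn: "bounded_clinear (T ^^ n)" by (rule bounded_clinear_funpow[OF bT])
  have cK: "compact_operator K" using assms(3) by (simp add: K_def)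
  have q: "0 \<le> op_noncompactness X" "0 \<le> op_noncompactness Q"
    using bX Q by (simp_all add: op_noncompactness_nonneg)
  define Y1 where "Y1 = (\<lambda>x. (- (inverse l ^ n)) *\<^sub>R (T ^^ n) (Q x))"
  define Y2 where "Y2 = (\<lambda>x. (- (l - r)) *\<^sub>R X (Q x))"
  define Y3 where "Y3 = (\<lambda>x. - X (K x))"
  have cY3: "compact_operator Y3"
    unfolding Y3_def by (rule compact_operator_minus[OF compact_operator_comp_left[OF cK bX]])
  have b1: "bounded_clinear (\<lambda>x. (T ^^ n) (Q x))" and b2: "bounded_clinear (\<lambda>x. X (Q x))"
    by (rule bounded_clinear_compose[OF bTn Q] bounded_clinear_compose[OF bX Q])+
  have bY: "bounded_clinear Y1" "bounded_clinear Y2" "bounded_clinear Y3"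
    unfolding Y1_def Y2_def
    by (rule bounded_clinear_compose[OF bounded_clinear_scaleR b1]
        bounded_clinear_compose[OF bounded_clinear_scaleR b2] compact_operatorD[OF cY3])+
  have "X x = ((Q x + Y1 x) + Y2 x) + Y3 x" for x
  proof -
    \<comment> \<open>As \<open>r - T\<close> times \<open>Q\<close> is the identity plus
      \<open>K\<close>, replacing \<open>r\<close> by \<open>l\<close> costs the term
      \<open>(l - r) *\<^sub>R Q x\<close>.\<close>
    have "(l *\<^sub>R Q x - T (Q x)) - (l - r) *\<^sub>R Q x - K x = x" by (simp add: K_def algebra_simps)
    then have "X x = X ((l *\<^sub>R Q x - T (Q x)) - (l - r) *\<^sub>R Q x - K x)" by (simp only:)
    also have "\<dots> = X (l *\<^sub>R Q x - T (Q x)) - (l - r) *\<^sub>R X (Q x) - X (K x)"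
      by (simp only: clinear_simps(2,5)[OF bX])
    also have "X (l *\<^sub>R Q x - T (Q x)) = Q x - inverse l ^ n *\<^sub>R (T ^^ n) (Q x)"
      unfolding X_def by (rule partial_resolvent_apply[OF bT l])
    finally show ?thesis unfolding Y1_def Y2_def Y3_def by (simp only: scaleR_minus_left) simp
  qed
  then have "X = (\<lambda>x. ((Q x + Y1 x) + Y2 x) + Y3 x)" by blast
  then have "op_noncompactness X \<le>
      op_noncompactness Q + op_noncompactness Y1 + op_noncompactness Y2 + op_noncompactness Y3"
    using op_noncompactness_add[OF Q bY(1)]
      op_noncompactness_add[OF bounded_clinear_add[OF Q bY(1)] bY(2)]
      op_noncompactness_add[OF bounded_clinear_add[OF bounded_clinear_add[OF Q bY(1)] bY(2)] bY(3)]
    by simp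
  moreover have "op_noncompactness Y3 = 0" by (rule op_noncompactness_compact[OF cY3])
  moreover have "op_noncompactness Y1 \<le> op_noncompactness Q"
  proof -
    have "op_noncompactness Y1 \<le> inverse l ^ n * op_noncompactness (\<lambda>x. (T ^^ n) (Q x))"
      unfolding Y1_def using op_noncompactness_scaleR[OF b1, of "- (inverse l ^ n)"] l by simp
    also have "\<dots> \<le> inverse l ^ n * (op_noncompactness (T ^^ n) * op_noncompactness Q)"
      using l op_noncompactness_comp[OF bTn Q] by (intro mult_left_mono) simp_all
    also have "\<dots> \<le> inverse l ^ n * (l ^ n * op_noncompactness Q)"
      using l n(2) q by (intro mult_left_mono mult_right_mono) simp_all
    also have "\<dots> = op_noncompactness Q" using l by (simp add: power_inverse)
    finally show ?thesis .
  qed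
  moreover have "op_noncompactness Y2 \<le> op_noncompactness X / 2"
  proof -
    have "op_noncompactness Y2 \<le> (l - r) * op_noncompactness (\<lambda>x. X (Q x))"
      unfolding Y2_def using op_noncompactness_scaleR[OF b2, of "- (l - r)"] r(2) by simp
    also have "\<dots> \<le> (l - r) * (op_noncompactness X * op_noncompactness Q)"
      using r(2) op_noncompactness_comp[OF bX Q] by (intro mult_left_mono) simp_all
    also have "\<dots> = ((l - r) * op_noncompactness Q) * op_noncompactness X" by simp
    also have "\<dots> \<le> 1 / 2 * op_noncompactness X" by (rule mult_right_mono[OF small q(1)])
    finally show ?thesis by simp
  qed
  ultimately have "op_noncompactness X \<le> 4 * op_noncompactness Q" by linarith
  \<comment> \<open>The terms of the series are positive operators, so the longer sum dominates the
    shorter one.\<close>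
  moreover have "op_noncompactness (partial_resolvent T l N) \<le> op_noncompactness X"
    unfolding X_def using partial_resolvent_mono[OF T l n(1)]
    by (intro op_noncompactness_dominates dominates_of_le positive_partial_resolvent[OF T l]
        bounded_clinear_partial_resolvent[OF bT])
  ultimately show ?thesis by linarith
qed

text \<open>In the product of the two sums, the pair of indices \<open>i\<close> and
  \<open>k - i\<close> produces \<open>T ^^ k\<close> with weight
  \<open>inverse l ^ (k + 2)\<close>. There are \<open>k + 1\<close> such pairs, and positivity lets
  the other terms be dropped.\<close>

lemma funpow_le_partial_resolvent_square:
  fixes T :: "'a::banach_lattice complexification \<Rightarrow> 'a complexification"
  assumes T: "positive_operator T" and l: "0 < l" and z: "0 \<le> z"
  shows "(real (Suc k) * inverse l ^ (k + 2)) *\<^sub>R (T ^^ k) z \<le>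
    partial_resolvent T l (Suc k) (partial_resolvent T l (Suc k) z)"
proof -
  let ?X = "partial_resolvent T l (Suc k)" and ?m = "inverse l"
  have m: "0 \<le> ?m" using l by simp
  have "?m ^ (k + 2) *\<^sub>R (T ^^ k) z \<le> ?m ^ Suc i *\<^sub>R (T ^^ i) (?X z)" if i: "i \<in> {..<Suc k}" for i
  proof -
    let ?f = "\<lambda>j. ?m ^ Suc j *\<^sub>R (T ^^ j) z"
    have f: "0 \<le> ?f j" for j
      using m positive_operatorD(2)[OF positive_operator_funpow[OF T] z]
      by (intro scaleR_nonneg_nonneg zero_le_power)
    have "sum ?f {k - i} \<le> sum ?f {..<Suc k}"
      using f by (intro sum_mono2) auto
    then have "?f (k - i) \<le> ?X z" by (simp add: partial_resolvent_def)
    then have "(T ^^ i) (?f (k - i)) \<le> (T ^^ i) (?X z)"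
      by (rule positive_operator_mono[OF positive_operator_funpow[OF T]])
    then have "?m ^ Suc i *\<^sub>R (T ^^ i) (?f (k - i)) \<le> ?m ^ Suc i *\<^sub>R (T ^^ i) (?X z)"
      using m by (intro scaleR_left_mono zero_le_power)
    moreover have "(T ^^ i) ((T ^^ (k - i)) z) = (T ^^ k) z"
      using i funpow_add[of i "k - i" T] by (simp add: o_def)
    moreover have "?m ^ Suc i * ?m ^ Suc (k - i) = ?m ^ (k + 2)"
      using i unfolding power_add[symmetric] by simp
    ultimately show ?thesis
      using clinear_simps(5)[OF positive_operatorD(1)[OF positive_operator_funpow[OF T, of i]]]
      by (simp only: scaleR_scaleR)
  qed
  then have "(\<Sum>i<Suc k. ?m ^ (k + 2) *\<^sub>R (T ^^ k) z) \<le> (\<Sum>i<Suc k. ?m ^ Suc i *\<^sub>R (T ^^ i) (?X z))"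
    by (rule sum_mono)
  moreover have "(\<Sum>i<Suc k. ?m ^ (k + 2) *\<^sub>R (T ^^ k) z) = (real (Suc k) * ?m ^ (k + 2)) *\<^sub>R (T ^^ k) z"
    by (simp only: sum_constant_scaleR card_lessThan scaleR_scaleR)
  ultimately show ?thesis
    unfolding partial_resolvent_def[of T l "Suc k" "?X z"] by (simp only:)
qed

text \<open>For \<open>l > r\<close> close to \<open>r\<close>, the square of the partial sum
  dominates a multiple of \<open>T ^^ k\<close> and has measure at most
  \<open>(4 * op_noncompactness Q)\<^sup>2\<close>. Then \<open>l\<close> tends to
  \<open>r\<close>.\<close>

lemma op_noncompactness_funpow_right_inverse_le:
  fixes T :: "'a::{atomic_banach_lattice, order_continuous_banach_lattice} complexification \<Rightarrow> 'a complexification"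
  assumes T: "positive_operator T" and Q: "bounded_clinear Q"
    and K: "compact_operator (\<lambda>x. (r *\<^sub>R Q x - T (Q x)) - x)" and r: "r = asymp_noncompactness T"
  shows "real (Suc k) * op_noncompactness (T ^^ k) \<le> 16 * (op_noncompactness Q)\<^sup>2 * r ^ (k + 2)"
proof -
  have bT: "bounded_clinear T" by (rule positive_operatorD(1)[OF T])
  have r0: "0 \<le> r" using r asymp_noncompactness_nonneg[OF bT] by simp
  have q: "0 \<le> op_noncompactness Q" by (rule op_noncompactness_nonneg[OF Q])
  have bTk: "bounded_clinear (T ^^ k)" by (rule bounded_clinear_funpow[OF bT])
  have main: "real (Suc k) * op_noncompactness (T ^^ k) \<le> 16 * (op_noncompactness Q)\<^sup>2 * l ^ (k + 2)"
    if rl: "r < l" and small: "(l - r) * op_noncompactness Q \<le> 1 / 2" for l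
  proof -
    have l: "0 < l" using r0 rl by simp
    define X where "X = partial_resolvent T l (Suc k)"
    define s where "s = real (Suc k) * inverse l ^ (k + 2)"
    have s: "0 < s" using l by (simp add: s_def)
    have bX: "bounded_clinear X" unfolding X_def by (rule bounded_clinear_partial_resolvent[OF bT])
    have qX: "op_noncompactness X \<le> 4 * op_noncompactness Q" "0 \<le> op_noncompactness X"
      unfolding X_def using op_noncompactness_partial_resolvent_le[OF T Q K r rl small]
        op_noncompactness_nonneg[OF bX[unfolded X_def]] by auto
    have bs: "bounded_clinear (\<lambda>z. s *\<^sub>R (T ^^ k) z)"
      by (rule bounded_clinear_compose[OF bounded_clinear_scaleR bTk])
    have "dominates (\<lambda>z. X (X z)) (\<lambda>z. s *\<^sub>R (T ^^ k) z)"
    proof (rule dominates_of_le)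
      show "positive_operator (\<lambda>z. s *\<^sub>R (T ^^ k) z)"
        unfolding positive_operator_def
        using bs s positive_operatorD(2)[OF positive_operator_funpow[OF T]] by (simp add: scaleR_nonneg_nonneg)
      show "s *\<^sub>R (T ^^ k) z \<le> X (X z)" if "0 \<le> z" for z
        unfolding s_def X_def by (rule funpow_le_partial_resolvent_square[OF T l that])
    qed
    then have "op_noncompactness (\<lambda>z. s *\<^sub>R (T ^^ k) z) \<le> op_noncompactness (\<lambda>z. X (X z))"
      by (rule op_noncompactness_dominates[OF bs bounded_clinear_compose[OF bX bX]])
    also have "\<dots> \<le> op_noncompactness X * op_noncompactness X" by (rule op_noncompactness_comp[OF bX bX])
    also have "\<dots> \<le> (4 * op_noncompactness Q) * (4 * op_noncompactness Q)"
      using qX q by (intro mult_mono) auto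
    finally have le: "op_noncompactness (\<lambda>z. s *\<^sub>R (T ^^ k) z) \<le> 16 * (op_noncompactness Q)\<^sup>2"
      by (simp add: power2_eq_square)
    have "op_noncompactness (T ^^ k) \<le> inverse s * op_noncompactness (\<lambda>z. s *\<^sub>R (T ^^ k) z)"
      using op_noncompactness_scaleR[OF bs, of "inverse s"] s by simp
    also have "\<dots> \<le> inverse s * (16 * (op_noncompactness Q)\<^sup>2)" using le s by (intro mult_left_mono) auto
    finally have "s * op_noncompactness (T ^^ k) \<le> 16 * (op_noncompactness Q)\<^sup>2"
      using s by (simp add: field_simps)
    then have "l ^ (k + 2) * (s * op_noncompactness (T ^^ k)) \<le> l ^ (k + 2) * (16 * (op_noncompactness Q)\<^sup>2)"
      using l by (intro mult_left_mono) auto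
    moreover have "l ^ (k + 2) * inverse l ^ (k + 2) = 1"
      using l unfolding power_mult_distrib[symmetric] by simp
    then have "l ^ (k + 2) * s = real (Suc k)" by (simp only: s_def mult.left_commute) simp
    then have "l ^ (k + 2) * (s * op_noncompactness (T ^^ k)) = real (Suc k) * op_noncompactness (T ^^ k)"
      by (simp only: mult.assoc[symmetric])
    ultimately show ?thesis by (simp only: mult.commute)
  qed
  \<comment> \<open>Any \<open>l\<close> with \<open>r < l \<le> r + d\<close> meets the smallness
    condition; the summand \<open>2\<close> keeps the denominator positive when \<chi>(Q) is
    \<open>0\<close>.\<close>
  define d where "d = 1 / (2 * op_noncompactness Q + 2)"
  have d: "0 < d" "d * op_noncompactness Q \<le> 1 / 2" using q by (auto simp: d_def field_simps)
  define l where "l n = r + d * inverse (real (Suc n))" for n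
  have "(\<lambda>n. 16 * (op_noncompactness Q)\<^sup>2 * l n ^ (k + 2)) \<longlonglongrightarrow>
      16 * (op_noncompactness Q)\<^sup>2 * (r + d * 0) ^ (k + 2)"
    unfolding l_def by (intro tendsto_intros LIMSEQ_inverse_real_of_nat)
  then have lim: "(\<lambda>n. 16 * (op_noncompactness Q)\<^sup>2 * l n ^ (k + 2)) \<longlonglongrightarrow>
      16 * (op_noncompactness Q)\<^sup>2 * r ^ (k + 2)" by simp
  show ?thesis
  proof (rule LIMSEQ_le_const[OF lim], intro exI[of _ 0] allI impI main)
    fix n
    show "r < l n" using d by (simp add: l_def)
    have "d * inverse (real (Suc n)) * op_noncompactness Q = (d * op_noncompactness Q) * inverse (real (Suc n))"
      by simp
    also have "\<dots> \<le> 1 / 2 * 1"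
      using d q by (intro mult_mono) (auto simp: inverse_eq_divide)
    finally show "(l n - r) * op_noncompactness Q \<le> 1 / 2" by (simp add: l_def)
  qed
qed

text \<open>A right inverse modulo compact operators would bound \<open>Suc k\<close> times \<chi>
  of the \<open>k\<close>-th power by a constant times \<open>r ^ (k + 2)\<close>, whereas that
  \<chi> is at least \<open>r ^ k\<close> for positive \<open>k\<close>; the linear factor is
  decisive for large \<open>k\<close>.\<close>

lemma asymp_noncompactness_in_essential_spectrum:
  fixes T :: "'a::{atomic_banach_lattice, order_continuous_banach_lattice} complexification \<Rightarrow> 'a complexification"
  assumes T: "positive_operator T" and nz: "0 < op_noncompactness (\<lambda>x::'a complexification. x)"
  shows "complex_of_real (asymp_noncompactness T) \<in> essential_spectrum T"
proof (rule ccontr)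
  assume c: "complex_of_real (asymp_noncompactness T) \<notin> essential_spectrum T"
  define r where "r = asymp_noncompactness T"
  have bT: "bounded_clinear T" by (rule positive_operatorD(1)[OF T])
  obtain Q where Q: "bounded_clinear Q" "compact_operator (\<lambda>x. (r *\<^sub>R Q x - T (Q x)) - x)"
    using not_in_essential_spectrum_right_inverse[OF bT c] unfolding scaleC_of_real r_def by blast
  have r0: "0 \<le> r" unfolding r_def by (rule asymp_noncompactness_nonneg[OF bT])
  define b where "b = 16 * (op_noncompactness Q)\<^sup>2"
  have le: "real (Suc k) * op_noncompactness (T ^^ k) \<le> b * r ^ (k + 2)" for k
    unfolding b_def by (rule op_noncompactness_funpow_right_inverse_le[OF T Q r_def])
  \<comment> \<open>The case \<open>k = 0\<close> bounds \<chi> of the identity and thereby excludes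
    \<open>r = 0\<close>, so that powers of \<open>r\<close> can be cancelled below.\<close>
  have "op_noncompactness (T ^^ 0) \<le> b * r ^ 2" using le[of 0] by (simp add: numeral_2_eq_2)
  moreover have "T ^^ 0 = (\<lambda>x. x)" by (simp add: id_def)
  ultimately have "0 < b * r ^ 2" using nz by simp
  then have r: "0 < r" using r0 by (cases "r = 0") auto
  obtain k :: nat where k: "b * r\<^sup>2 < real k" using reals_Archimedean2 by blast
  have "real (Suc (Suc k)) * r ^ Suc k \<le> real (Suc (Suc k)) * op_noncompactness (T ^^ Suc k)"
    using asymp_noncompactness_power_le[OF bT, of k] unfolding r_def by (intro mult_left_mono) auto
  also have "\<dots> \<le> b * r ^ (Suc k + 2)" by (rule le)
  also have "\<dots> = (b * r\<^sup>2) * r ^ Suc k" by (simp only: power_add mult_ac)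
  finally have "real (Suc (Suc k)) \<le> b * r\<^sup>2" using r by (simp add: mult_le_cancel_right)
  then show False using k by simp
qed

section \<open>Comparison of the essential spectral radius with \<rho>\<close>

lemma essential_spectral_radius_bounds:
  fixes T :: "'a::{atomic_banach_lattice, order_continuous_banach_lattice} complexification \<Rightarrow> 'a complexification"
  assumes T: "bounded_clinear T"
  shows "0 \<le> essential_spectral_radius T" "essential_spectral_radius T \<le> asymp_noncompactness T"
    "c \<in> essential_spectrum T \<Longrightarrow> cmod c \<le> essential_spectral_radius T"
proof -
  have b: "x \<le> asymp_noncompactness T" if "x \<in> insert 0 (cmod ` essential_spectrum T)" for x
    using that essential_spectrum_bound[OF T] asymp_noncompactness_nonneg[OF T] by auto
  then have bdd: "bdd_above (insert 0 (cmod ` essential_spectrum T))" by (rule bdd_aboveI)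
  show "0 \<le> essential_spectral_radius T" "c \<in> essential_spectrum T \<Longrightarrow> cmod c \<le> essential_spectral_radius T"
    unfolding essential_spectral_radius_def by (auto intro!: cSup_upper[OF _ bdd])
  show "essential_spectral_radius T \<le> asymp_noncompactness T"
    unfolding essential_spectral_radius_def using b by (intro cSup_least) auto
qed

lemma essential_spectral_radius_positive:
  fixes T :: "'a::{atomic_banach_lattice, order_continuous_banach_lattice} complexification \<Rightarrow> 'a complexification"
  assumes T: "positive_operator T"
  shows "essential_spectral_radius T = asymp_noncompactness T"
proof (rule antisym)
  have bT: "bounded_clinear T" by (rule positive_operatorD(1)[OF T])
  note bounds = essential_spectral_radius_bounds[OF bT]
  show "essential_spectral_radius T \<le> asymp_noncompactness T" by (rule bounds(2))
  show "asymp_noncompactness T \<le> essential_spectral_radius T"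
  proof (cases "0 < op_noncompactness (\<lambda>x::'a complexification. x)")
    case True
    then show ?thesis
      using bounds(3)[OF asymp_noncompactness_in_essential_spectrum[OF T]]
        asymp_noncompactness_nonneg[OF bT] by simp
  next
    case False
    then have "op_noncompactness (\<lambda>x::'a complexification. x) = 0"
      using op_noncompactness_nonneg[OF bounded_clinear_ident] by (metis antisym_conv2)
    \<comment> \<open>Writing \<open>T\<close> as \<open>T\<close> times the identity,
      submultiplicativity makes \<chi>(T) vanish, and both radii are \<open>0\<close> in this
      degenerate case.\<close>
    then have "op_noncompactness T \<le> 0"
      using op_noncompactness_comp[OF bT bounded_clinear_ident] by simp
    then have "asymp_noncompactness T \<le> 0"
      using asymp_noncompactness_power_le[OF bT, of 0] by simp
    then show ?thesis using bounds(1) by simp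
  qed
qed

text \<open>The powers of \<open>T\<close> dominate those of \<open>S\<close>, so \<rho>(S) \<le>
  \<rho>(T). For \<open>S\<close> only the upper bound by \<rho> is used; for \<open>T\<close>,
  positive by domination, \<rho> is the essential spectral radius.\<close>

lemma essential_spectral_radius_dominates:
  fixes S T :: "'a::{atomic_banach_lattice, order_continuous_banach_lattice} complexification \<Rightarrow> 'a complexification"
  assumes S: "bounded_clinear S" and T: "bounded_clinear T" and dom: "dominates T S"
  shows "essential_spectral_radius S \<le> essential_spectral_radius T"
proof -
  have pos: "positive_operator T" by (rule dominates_positive[OF T dom])
  have "essential_spectral_radius S \<le> asymp_noncompactness S" by (rule essential_spectral_radius_bounds[OF S])
  also have "\<dots> \<le> asymp_noncompactness T"
    by (intro asymp_noncompactness_mono S op_noncompactness_dominates bounded_clinear_funpow T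
        dominates_funpow pos dom)
  also have "\<dots> = essential_spectral_radius T" by (simp add: essential_spectral_radius_positive[OF pos])
  finally show ?thesis .
qed

theorem theorem12:
  shows "(\<forall>T :: 'e::{atomic_banach_lattice, order_continuous_banach_lattice} complexification
              \<Rightarrow> 'e complexification.
            \<not> (\<exists>B :: 'e complexification set. finite B \<and> span B = UNIV) \<longrightarrow>
            positive_operator T \<longrightarrow>
            complex_of_real (essential_spectral_radius T) \<in> essential_spectrum T)
       \<and> (\<forall>S T :: 'e complexification \<Rightarrow> 'e complexification.
            bounded_clinear S \<longrightarrow> bounded_clinear T \<longrightarrow> dominates T S \<longrightarrow>
            essential_spectral_radius S \<le> essential_spectral_radius T)
       \<and> (\<forall>S T :: 'e complexification
              \<Rightarrow> 'f::{atomic_banach_lattice, order_continuous_banach_lattice} complexification.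
            bounded_clinear S \<longrightarrow> bounded_clinear T \<longrightarrow> dominates T S \<longrightarrow>
            op_noncompactness S \<le> op_noncompactness T)"
proof (intro conjI allI impI)
  fix T :: "'e complexification \<Rightarrow> 'e complexification"
  assume inf: "\<not> (\<exists>B :: 'e complexification set. finite B \<and> span B = UNIV)" and T: "positive_operator T"
  \<comment> \<open>In finite dimension the Calkin algebra is zero and the essential spectrum is
    empty. Outside it, \<chi> of the identity is at least \<open>1\<close>, hence positive.\<close>
  have "\<not> op_noncompactness (\<lambda>x::'e complexification. x) < 1"
    by (rule contrapos_nn[OF inf]) (rule finite_dim_of_op_noncompactness_id)
  then have "0 < op_noncompactness (\<lambda>x::'e complexification. x)" by linarith
  then show "complex_of_real (essential_spectral_radius T) \<in> essential_spectrum T"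
    unfolding essential_spectral_radius_positive[OF T]
    by (rule asymp_noncompactness_in_essential_spectrum[OF T])
next
  fix S T :: "'e complexification \<Rightarrow> 'e complexification"
  assume "bounded_clinear S" "bounded_clinear T" "dominates T S"
  then show "essential_spectral_radius S \<le> essential_spectral_radius T"
    by (rule essential_spectral_radius_dominates)
next
  fix S :: "'e complexification \<Rightarrow> 'f complexification" and T
  assume "bounded_clinear S" "bounded_clinear T" "dominates T S"
  then show "op_noncompactness S \<le> op_noncompactness T"
    by (rule op_noncompactness_dominates)
qed

end
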